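(* Let $V:\mathbb{R}^d\to\mathbb{R}^d$ and let $x^*$ be an isolated solution of $V(x)=0$. Suppose that there is a neighborhood $\mathcal{U}_0$ of $x^*$ and constants $L\ge0$, $q>3$, $\sigma,\varkappa\ge0$ such that: (1') $\|V(x')-V(x)\|\le L\|x'-x\|$ for all $x,x'\in\mathcal{U}_0$; (2') for all $t\in\{1,3/2,2,\dots\}$, $\mathbb{E}[Z_t\mid\mathcal{F}_t]\,\mathbf{1}_{\{X_t\in\mathcal{U}_0\}}=0$ and $\mathbb{E}[\|Z_t\|^q\mid\mathcal{F}_t]\,\mathbf{1}_{\{X_t\in\mathcal{U}_0\}}\le(\sigma+\varkappa\|X_t-x^*\|)^q$; (3') $\langle V(x),x-x^*\rangle\ge0$ for all $x\in\mathcal{U}_0$; (5') $V$ is differentiable at $x^*$ and its Jacobian matrix at $x^*$ is invertible. Fix a tolerance level $\delta>0$, and suppose the double stepsize extragradient algorithm is run with stepsizes $\gamma_t=\gamma/(t+b)^{1/3}$ and $\eta_t=\eta/(t+b)^{2/3}$, where $\gamma>0$ and where $\eta>0$ and $b>0$ are large enough. Then there exist neighborhoods $\mathcal{U}$, $\mathcal{U}'$ of $x^*$ and an event $E_{\mathcal{U}}$ such that: (a) $\mathbb{P}(E_{\mathcal{U}}\mid X_1\in\mathcal{U})\ge1-\delta$; (b) $\mathbb{P}(X_t\in\mathcal{U}'\text{ for all }t\mid E_{\mathcal{U}})=1$; (c) $\mathbb{E}[\|X_t-x^*\|^2\mid E_{\mathcal{U}}]=O(1/t^{1/3})$. (Here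 $t$ ranges over positive integers.)
   Context: The double stepsize extragradient (DSEG) algorithm is, for integers $t=1,2,\dots$, $$X_{t+1/2}=X_t-\gamma_t\hat V_t,\qquad X_{t+1}=X_t-\eta_t\hat V_{t+1/2},$$ with stepsizes $\gamma_t\ge\eta_t>0$. For each $t\in\{1,3/2,2,\dots\}$ the stochastic oracle returns $\hat V_t=V(X_t)+Z_t$, where $Z_t$ is an additive random noise vector (all $X_t$ are random vectors). $\mathcal{F}_t$ denotes the history (natural filtration), i.e. the $\sigma$-algebra generated by $X_s$, $s\le t$, $s\in\{1,3/2,2,\dots\}$. $\|\cdot\|$ is the Euclidean norm. The noise hypotheses hold with the same neighborhood $\mathcal{U}_0$ and constants $q,\sigma,\varkappa$ for every choice of stepsizes and initialization considered. "Large enough" means: for given $\gamma$, for all $\eta$ above some threshold, and then for all $b$ above some threshold which may depend on $\gamma,\eta$; thresholds may depend on the data of the problem and on $\delta$. The neighborhoods $\mathcal{U},\mathcal{U}'$ do not depend on the initialization $X_1$, and conditional probabilities given $X_1\in\mathcal{U}$ presuppose $\mathbb{P}(X_1\in\mathcal{U})>0$. *)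

theory Defs
  imports "HOL-Probability.Probability"
begin

text \<open>
  Processes indexed by the half-integers \<open>1, 3/2, 2, \<dots>\<close> are represented as functions of the doubled
  index: \<open>X n\<close> stands for $X_{n/2}$, and only the indices \<open>n \<ge> 2\<close> are meaningful.  So, for an
  integer \<open>t \<ge> 1\<close>, \<open>X (2 * t)\<close> is $X_t$ and \<open>X (2 * t + 1)\<close> is $X_{t+1/2}$.
  The step-size sequences are indexed by the integers \<open>t \<ge> 1\<close> themselves.
\<close>

definition history ::
  "'w measure \<Rightarrow> (nat \<Rightarrow> 'w \<Rightarrow> 'b::topological_space) \<Rightarrow> nat \<Rightarrow> 'w measure" where
  "history M X n =
     sigma (space M) {X s -` A \<inter> space M | s A. s \<in> {2..n} \<and> A \<in> sets borel}"

definition vec_cond_exp ::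
  "'w measure \<Rightarrow> 'w measure \<Rightarrow> ('w \<Rightarrow> real ^ 'd) \<Rightarrow> 'w \<Rightarrow> real ^ 'd" where
  "vec_cond_exp M F f \<omega> = (\<chi> i. real_cond_exp M F (\<lambda>\<omega>'. f \<omega>' $ i) \<omega>)"

locale dseg = prob_space M
  for M :: "'w measure" +
  fixes V :: "real ^ 'd \<Rightarrow> real ^ 'd"
    and \<gamma> \<eta> :: "nat \<Rightarrow> real"
    and X Z :: "nat \<Rightarrow> 'w \<Rightarrow> real ^ 'd"
  assumes stepsizes: "\<And>t. t \<ge> 1 \<Longrightarrow> 0 < \<eta> t \<and> \<eta> t \<le> \<gamma> t"
    and X_measurable: "\<And>n. n \<ge> 2 \<Longrightarrow> X n \<in> borel_measurable M"
    and Z_measurable: "\<And>n. n \<ge> 2 \<Longrightarrow> Z n \<in> borel_measurable M"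
    and extrapolation: "\<And>t \<omega>. t \<ge> 1 \<Longrightarrow> \<omega> \<in> space M \<Longrightarrow>
      X (2 * t + 1) \<omega> = X (2 * t) \<omega> - \<gamma> t *\<^sub>R (V (X (2 * t) \<omega>) + Z (2 * t) \<omega>)"
    and update: "\<And>t \<omega>. t \<ge> 1 \<Longrightarrow> \<omega> \<in> space M \<Longrightarrow>
      X (2 * t + 2) \<omega> = X (2 * t) \<omega> - \<eta> t *\<^sub>R (V (X (2 * t + 1) \<omega>) + Z (2 * t + 1) \<omega>)"

text \<open>
  The moment bound is stated with \<^const>\<open>nn_cond_exp\<close>, which may take the value \<open>\<infinity>\<close>; so it
  does assert that the conditional moment is finite where \<open>X n\<close> lies in \<open>U\<^sub>0\<close>.  There the
  conditional first moment is then finite as well, and \<^const>\<open>real_cond_exp\<close> is the genuine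
  conditional expectation.  Nothing is required of the noise outside \<open>U\<^sub>0\<close>.
\<close>

definition local_noise ::
  "'w measure \<Rightarrow> (nat \<Rightarrow> 'w \<Rightarrow> real ^ 'd) \<Rightarrow> (nat \<Rightarrow> 'w \<Rightarrow> real ^ 'd) \<Rightarrow>
   real ^ 'd \<Rightarrow> (real ^ 'd) set \<Rightarrow> real \<Rightarrow> real \<Rightarrow> real \<Rightarrow> bool" where
  "local_noise M X Z x\<^sub>0 U\<^sub>0 q \<sigma> \<kappa> \<longleftrightarrow>
     (\<forall>n\<ge>2.
       (AE \<omega> in M.
          indicat_real U\<^sub>0 (X n \<omega>) *\<^sub>R vec_cond_exp M (history M X n) (Z n) \<omega> = 0) \<and>
       (AE \<omega> in M.
          nn_cond_exp M (history M X n) (\<lambda>\<omega>'. ennreal (norm (Z n \<omega>') powr q)) \<omega>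
            * indicator U\<^sub>0 (X n \<omega>)
          \<le> ennreal ((\<sigma> + \<kappa> * norm (X n \<omega> - x\<^sub>0)) powr q)))"

end

theory Submission
  imports Defs
begin

text \<open>
  Write \<open>r\<^sub>t = X\<^sub>t - x\<^sup>*\<close>.  Expanding \<open>\<parallel>r\<^bsub>t+1\<^esub>\<parallel>\<^sup>2\<close> and moving the base point of the inner product from
  \<open>X\<^sub>t\<close> to \<open>X\<^bsub>t+1/2\<^esub>\<close>, where monotonicity applies, leaves the term
  \<open>-2 \<gamma>\<^sub>t \<eta>\<^sub>t \<langle>V(X\<^bsub>t+1/2\<^esub>), V(X\<^sub>t) + Z\<^sub>t\<rangle>\<close>.  By the Lipschitz condition this is at most
  \<open>-\<gamma>\<^sub>t \<eta>\<^sub>t \<parallel>V(X\<^sub>t)\<parallel>\<^sup>2\<close>, up to martingale terms and errors of order \<open>\<eta>\<^sub>t \<gamma>\<^sub>t\<^sup>2 \<parallel>Z\<^sub>t\<parallel>\<^sup>2\<close> and \<open>\<eta>\<^sub>t\<^sup>2\<close>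
  (lemma \<open>extragradient_step\<close>).  An invertible Jacobian gives \<open>\<parallel>V(x)\<parallel> \<ge> m \<parallel>x - x\<^sup>*\<parallel>\<close> near \<open>x\<^sup>*\<close>, so as
  long as the process stays near \<open>x\<^sup>*\<close> the mean squared error contracts by \<open>1 - \<gamma>\<^sub>t \<eta>\<^sub>t m\<^sup>2\<close>, where
  \<open>\<gamma>\<^sub>t \<eta>\<^sub>t = \<gamma> \<eta> / (t + b)\<close>, with an additive error of order \<open>(t + b)\<^bsup>-4/3\<^esup>\<close>.  If \<open>\<gamma> \<eta> m\<^sup>2 \<ge> 2\<close>, this
  recursion forces the rate \<open>t\<^bsup>-1/3\<^esup>\<close> (lemma \<open>recursion_rate_one_third\<close>).

  All hypotheses are local, so every expectation is taken on the decreasing events \<open>good n\<close>: up to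
  the doubled index \<open>n\<close> the integer iterates have stayed in the ball of radius \<open>\<rho>\<close> and the half
  iterates in the ball of radius \<open>2 \<rho>\<close>.  These events belong to the history, hence the noise remains
  centred on them.  The exception is that the noise \<open>Z\<^sub>t\<close> helps to decide whether the half step stays
  in the large ball; on the part that is cut away \<open>\<gamma>\<^sub>t \<parallel>Z\<^sub>t\<parallel> \<ge> \<rho> / 2\<close>, and this turns the uncentred
  remainder into one more error of order \<open>\<eta>\<^sub>t \<gamma>\<^sub>t\<^sup>2 \<parallel>Z\<^sub>t\<parallel>\<^sup>2\<close>.

  Why the process survives.  A half step leaves the large ball with probability of order
  \<open>\<gamma>\<^sub>t\<^sup>q = O((t + b)\<^bsup>-q/3\<^esup>)\<close>, which is summable because \<open>q > 3\<close>.  An integer step that leaves the small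
  ball has \<open>\<parallel>r\<^bsub>t+1\<^esub>\<parallel>\<^sup>2 > \<rho>\<^sup>2\<close>, so the mass lost there, times \<open>\<rho>\<^sup>2\<close>, can be kept on the left-hand side of
  the recursion for the squared error (lemma \<open>drift\<close>).  Telescoping bounds the total loss by the
  initial error over \<open>\<rho>\<^sup>2\<close> plus a series that is small for large \<open>b\<close> (lemmas \<open>prob_good_loss\<close> and
  \<open>prob_all_good\<close>).  The event \<open>E\<close> is the intersection of all the \<open>good n\<close>,
  and the error on \<open>E\<close> is at most the error on \<open>good (2 t)\<close>.
\<close>

section \<open>The Jacobian and one deterministic step\<close>

lemma norm_lower_bound_of_invertible_jacobian:
  fixes V :: "real ^ 'd \<Rightarrow> real ^ 'd"
  assumes diff: "V differentiable (at x)" and inv: "invertible (jacobian V (at x))"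
  obtains m r where "m > 0" "r > 0" "\<And>y. dist x y < r \<Longrightarrow> m * norm (y - x) \<le> norm (V y - V x)"
proof -
  let ?J = "(*v) (jacobian V (at x))"
  obtain B where B: "B > 0" "\<And>h. B * norm h \<le> norm (?J h)"
    using linear_inj_bounded_below_pos[OF matrix_vector_mul_linear inj_matrix_vector_mult[OF inv]]
    by blast
  have "(V has_derivative ?J) (at x)"
    using diff jacobian_works by blast
  then obtain d where d: "d > 0"
    "\<And>y. norm (y - x) < d \<Longrightarrow> norm (V y - V x - ?J (y - x)) \<le> B / 2 * norm (y - x)"
    using B(1) unfolding has_derivative_at_alt by (meson half_gt_zero)
  have "B / 2 * norm (y - x) \<le> norm (V y - V x)" if "dist x y < d" for y
  proof -
    have "norm (V y - V x - ?J (y - x)) \<le> B / 2 * norm (y - x)"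
      using d(2)[of y] that by (simp add: dist_norm norm_minus_commute[of x y])
    moreover have "norm (?J (y - x)) \<le> norm (V y - V x) + norm (V y - V x - ?J (y - x))"
      using norm_triangle_ineq4[of "V y - V x" "V y - V x - ?J (y - x)"] by simp
    ultimately show ?thesis
      using B(2)[of "y - x"] by linarith
  qed
  then show thesis
    using that[of "B / 2" d] B d by auto
qed

text \<open>
  One step, with both noise vectors still arbitrary.  The operator at the noisy half iterate \<open>y\<close>
  depends on \<open>z\<close>; replacing it by its value at the noiseless half iterate costs only
  \<open>L g \<parallel>z\<parallel>\<close> and leaves an inner product with \<open>z\<close> whose first factor depends on \<open>x\<close> alone, so that it
  can later be averaged out.
\<close>

lemma extragradient_step:
  fixes V :: "'a::real_inner \<Rightarrow> 'a"
  assumes lip: "\<And>x y. x \<in> cball xs (2 * \<rho>) \<Longrightarrow> y \<in> cball xs (2 * \<rho>) \<Longrightarrow>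
      norm (V y - V x) \<le> L * norm (y - x)"
    and mono: "\<And>x. x \<in> cball xs (2 * \<rho>) \<Longrightarrow> V x \<bullet> (x - xs) \<ge> 0"
    and zero: "V xs = 0"
    and x: "x \<in> cball xs \<rho>"
    and y: "y = x - g *\<^sub>R (V x + z)" "y \<in> cball xs (2 * \<rho>)"
    and xt: "x - g *\<^sub>R V x \<in> cball xs (2 * \<rho>)"
    and L: "L \<ge> 0" and g: "g > 0" "3 * (L * g) \<le> 1" and h: "h > 0"
  shows "(norm (x - h *\<^sub>R (V y + z') - xs))\<^sup>2 + g * h * (norm (V x))\<^sup>2
    \<le> (norm (x - xs))\<^sup>2 - 2 * h * ((x - xs) \<bullet> z') - 2 * h * g * (V (x - g *\<^sub>R V x) \<bullet> z)
      + 3 * L * h * g\<^sup>2 * (norm z)\<^sup>2 + h\<^sup>2 * (8 * L\<^sup>2 * \<rho>\<^sup>2 + 2 * (norm z')\<^sup>2)"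
proof -
  define r v w where "r = x - xs" and "v = V x" and "w = V y"
  define y' w' where "y' = x - g *\<^sub>R v" and "w' = V y'"
  have y': "y' \<in> cball xs (2 * \<rho>)" using xt by (simp add: y'_def v_def)
  have \<rho>: "\<rho> \<ge> 0" using x by (metis dist_not_less_zero mem_cball le_less_trans not_less)
  have x2: "x \<in> cball xs (2 * \<rho>)" using x \<rho> by simp
  have wle: "norm w \<le> 2 * L * \<rho>"
  proof -
    have "norm (V y - V xs) \<le> L * norm (y - xs)" using lip[of xs y] y \<rho> by simp
    also have "\<dots> \<le> L * (2 * \<rho>)"
      using y(2) L by (intro mult_left_mono) (auto simp: dist_norm norm_minus_commute)
    finally show ?thesis by (simp add: zero w_def mult_ac)
  qed
  have ww': "norm (w - w') \<le> L * g * norm z"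
  proof -
    have "norm (w - w') \<le> L * norm (y - y')" unfolding w_def w'_def using lip y(2) y' by blast
    also have "y - y' = - (g *\<^sub>R z)" by (simp add: y'_def y v_def scaleR_add_right)
    finally show ?thesis using g by simp
  qed
  have vw': "norm (w' - v) \<le> L * g * norm v"
  proof -
    have "norm (w' - v) \<le> L * norm (y' - x)" unfolding v_def w'_def using lip x2 y' by blast
    then show ?thesis using g by (simp add: y'_def)
  qed
  \<comment> \<open>Monotonicity is available at the half iterate; the shift of base point produces the descent term.\<close>
  have i1: "w \<bullet> r \<ge> g * (w \<bullet> (v + z))"
  proof -
    have "w \<bullet> (y - xs) \<ge> 0" unfolding w_def using mono y(2) by blast
    moreover have "y - xs = r - g *\<^sub>R (v + z)" by (simp add: y r_def v_def)
    ultimately show ?thesis by (simp add: inner_diff_right)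
  qed
  \<comment> \<open>Half of the squared norm survives because each Lipschitz correction costs at most a third or a sixth of it.\<close>
  have i2: "w \<bullet> (v + z) \<ge> (norm v)\<^sup>2 / 2 - 3/2 * (L * g) * (norm z)\<^sup>2 + w' \<bullet> z"
  proof -
    have e: "w \<bullet> (v + z) = v \<bullet> v + (w' - v) \<bullet> v + w' \<bullet> z + (w - w') \<bullet> (v + z)"
      by (simp add: inner_diff_left inner_add_right)
    have a: "(w' - v) \<bullet> v \<ge> - (L * g * (norm v)\<^sup>2)"
    proof -
      have "\<bar>(w' - v) \<bullet> v\<bar> \<le> norm (w' - v) * norm v" by (rule Cauchy_Schwarz_ineq2)
      also have "\<dots> \<le> L * g * norm v * norm v" using vw' by (intro mult_right_mono) auto
      finally show ?thesis by (simp add: power2_eq_square)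
    qed
    have b: "(w - w') \<bullet> (v + z) \<ge> - (L * g * (norm z * norm v + (norm z)\<^sup>2))"
    proof -
      have "\<bar>(w - w') \<bullet> (v + z)\<bar> \<le> norm (w - w') * norm (v + z)" by (rule Cauchy_Schwarz_ineq2)
      also have "\<dots> \<le> L * g * norm z * (norm v + norm z)"
        using ww' L g by (intro mult_mono norm_triangle_ineq) auto
      finally show ?thesis by (simp add: power2_eq_square algebra_simps)
    qed
    have c: "L * g * (norm z * norm v) \<le> L * g * ((norm z)\<^sup>2 / 2 + (norm v)\<^sup>2 / 2)"
      using L g sum_squares_bound[of "norm z" "norm v"] by (intro mult_left_mono) auto
    have d: "L * g * (norm v)\<^sup>2 \<le> (norm v)\<^sup>2 / 3"
      using mult_right_mono[OF g(2), of "(norm v)\<^sup>2"] by simp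
    have "v \<bullet> v = (norm v)\<^sup>2" by (simp add: dot_square_norm)
    with e a b c d show ?thesis by (simp add: algebra_simps)
  qed
  have exp: "(norm (r - h *\<^sub>R (w + z')))\<^sup>2 =
      (norm r)\<^sup>2 - 2 * h * (w \<bullet> r) - 2 * h * (r \<bullet> z') + h\<^sup>2 * (norm (w + z'))\<^sup>2"
    unfolding power2_norm_eq_inner
    by (simp add: algebra_simps inner_commute power2_eq_square)
  have i3: "h * (g * ((norm v)\<^sup>2 / 2 - 3/2 * (L * g) * (norm z)\<^sup>2 + w' \<bullet> z)) \<le> h * (w \<bullet> r)"
  proof -
    have "g * ((norm v)\<^sup>2 / 2 - 3/2 * (L * g) * (norm z)\<^sup>2 + w' \<bullet> z) \<le> g * (w \<bullet> (v + z))"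
      using i2 g by (intro mult_left_mono) auto
    then show ?thesis using i1 h by (intro mult_left_mono) auto
  qed
  have i4: "(norm (w + z'))\<^sup>2 \<le> 8 * L\<^sup>2 * \<rho>\<^sup>2 + 2 * (norm z')\<^sup>2"
  proof -
    have "(norm (w + z'))\<^sup>2 \<le> (norm w + norm z')\<^sup>2"
      by (intro power_mono norm_triangle_ineq) auto
    also have "\<dots> \<le> 2 * (norm w)\<^sup>2 + 2 * (norm z')\<^sup>2"
      using sum_squares_bound[of "norm w" "norm z'"] by (simp add: power2_sum)
    also have "(norm w)\<^sup>2 \<le> (2 * L * \<rho>)\<^sup>2" using wle by (intro power_mono) auto
    finally show ?thesis by (simp add: power_mult_distrib)
  qed
  have "h\<^sup>2 * (norm (w + z'))\<^sup>2 \<le> h\<^sup>2 * (8 * L\<^sup>2 * \<rho>\<^sup>2 + 2 * (norm z')\<^sup>2)"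
    using i4 by (intro mult_left_mono) auto
  with exp i3 have "(norm (r - h *\<^sub>R (w + z')))\<^sup>2 + g * h * (norm v)\<^sup>2 \<le> (norm r)\<^sup>2 - 2 * h * (r \<bullet> z')
      - 2 * h * g * (w' \<bullet> z) + 3 * L * h * g\<^sup>2 * (norm z)\<^sup>2 + h\<^sup>2 * (8 * L\<^sup>2 * \<rho>\<^sup>2 + 2 * (norm z')\<^sup>2)"
    by (simp add: algebra_simps power2_eq_square)
  moreover have "x - h *\<^sub>R (w + z') - xs = r - h *\<^sub>R (w + z')" by (simp add: r_def)
  ultimately show ?thesis by (simp only: w_def v_def r_def w'_def y'_def)
qed

section \<open>Step-size sequences\<close>

text \<open>
  Induction on the bound \<open>A (t + b)\<^bsup>-1/3\<^esup>\<close>.  Passing from \<open>s = t + b\<close> to \<open>s + 1\<close> shrinks this bound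
  by a factor of at least \<open>1 - 1/s\<close>, because \<open>((s + 1) / s)\<^bsup>1/3\<^esup> \<le> (s + 1) / s\<close>.  The contraction
  \<open>1 - p/s\<close> with \<open>p \<ge> 2\<close> thus leaves room \<open>1/s\<close> to absorb the additive error as soon as \<open>A \<ge> C\<close>.
\<close>

lemma recursion_rate_one_third:
  fixes a :: "nat \<Rightarrow> real"
  assumes rec: "\<And>t. t \<ge> 1 \<Longrightarrow>
      a (Suc t) \<le> (1 - p / (real t + b)) * a t + C / (real t + b) powr (4/3)"
    and p: "2 \<le> p" and pb: "p \<le> 1 + b" and b: "b > 0" and C: "C \<ge> 0"
  shows "\<exists>A. \<forall>t\<ge>1. a t \<le> A / (real t + b) powr (1/3)"
proof -
  define A where "A = max C (a 1 * (1 + b) powr (1/3))"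
  have A: "C \<le> A" "0 \<le> A" using C by (auto simp: A_def)
  have "a t \<le> A / (real t + b) powr (1/3)" if "t \<ge> 1" for t
    using that
  proof (induction t rule: nat_induct_at_least)
    case base
    have "a 1 * (1 + b) powr (1/3) \<le> A" by (simp add: A_def)
    then show ?case using b by (simp add: pos_le_divide_eq)
  next
    case (Suc t)
    define s where "s = real t + b"
    have s: "s > 0" "p \<le> s" using Suc pb b by (auto simp: s_def)
    define c where "c = s powr (1/3)"
    have c: "c > 0" using s by (simp add: c_def)
    have s43: "s powr (4/3) = s * c"
      using s powr_add[of s 1 "1/3"] by (simp add: c_def)
    have "a (Suc t) \<le> (1 - p / s) * a t + C / s powr (4/3)"
      using rec Suc by (simp add: s_def)
    also have "\<dots> \<le> (1 - p / s) * (A / c) + A / (s * c)"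
      unfolding s43 using Suc s c A
      by (intro add_mono mult_left_mono divide_right_mono) (auto simp: s_def c_def)
    also have "\<dots> = A / c * (1 - (p - 1) / s)"
      using s c by (simp add: field_simps)
    also have "\<dots> \<le> A / c * (1 - 1 / s)"
      using A c s p by (intro mult_left_mono) (auto simp: field_simps)
    also have "\<dots> \<le> A / c * (s / (s + 1))"
      using A c s by (intro mult_left_mono) (auto simp: field_simps)
    also have "\<dots> = A / (c * ((s + 1) / s))" by simp
    also have "\<dots> \<le> A / ((s + 1) powr (1/3))"
    proof (intro divide_left_mono)
      have "((s + 1) / s) powr (1/3) \<le> ((s + 1) / s) powr 1"
        using s by (intro powr_mono) (auto simp: field_simps)
      then have "c * ((s + 1) / s) powr (1/3) \<le> c * ((s + 1) / s)"
        using c s by (intro mult_left_mono) auto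
      moreover have "c * ((s + 1) / s) powr (1/3) = (s + 1) powr (1/3)"
        using s by (simp add: c_def powr_divide)
      ultimately show "(s + 1) powr (1/3) \<le> c * ((s + 1) / s)" by simp
    qed (use A c s in auto)
    finally show ?case by (simp add: s_def add_ac)
  qed
  then show ?thesis by blast
qed

text \<open>
  Write \<open>p = (1 + d) + d\<close>: one part of the exponent makes the series converge uniformly in \<open>b\<close>, the
  other yields the factor \<open>b\<^bsup>-d\<^esup>\<close>, which tends to \<open>0\<close>.
\<close>

lemma eventually_shifted_power_sum_le:
  fixes C \<epsilon> p :: real
  assumes p: "p > 1" and C: "C \<ge> 0" and \<epsilon>: "\<epsilon> > 0"
  shows "\<forall>\<^sub>F b in at_top. \<forall>T. (\<Sum>t=1..T::nat. C / (real t + b) powr p) \<le> \<epsilon>"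
proof -
  define d where "d = (p - 1) / 2"
  have d: "d > 0" "p = (1 + d) + d" using p by (auto simp: d_def field_simps)
  define S where "S = (\<Sum>t. 1 / real t powr (1 + d))"
  have summ: "summable (\<lambda>t. 1 / real t powr (1 + d))"
    unfolding powr_minus_divide[symmetric] summable_real_powr_iff using d by simp
  have "((\<lambda>b. C * S * b powr (-d)) \<longlongrightarrow> C * S * 0) at_top"
    using d by (intro tendsto_intros tendsto_neg_powr filterlim_ident) auto
  then have "\<forall>\<^sub>F b in at_top. C * S * b powr (-d) < \<epsilon>"
    using \<epsilon> order_tendstoD(2) by fastforce
  with eventually_gt_at_top[of 0] show ?thesis
  proof eventually_elim
    case (elim b)
    show ?case
    proof
      fix T
      have "(\<Sum>t=1..T. C / (real t + b) powr p) \<le> (\<Sum>t=1..T. C * b powr (-d) * (1 / real t powr (1 + d)))"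
      proof (intro sum_mono)
        fix t assume t: "t \<in> {1..T}"
        have "real t powr (1 + d) * b powr d \<le> (real t + b) powr (1 + d) * (real t + b) powr d"
          using elim d t by (intro mult_mono powr_mono2) auto
        also have "\<dots> = (real t + b) powr p" by (simp only: d(2) powr_add)
        finally have "C / (real t + b) powr p \<le> C / (real t powr (1 + d) * b powr d)"
          using elim t C by (intro divide_left_mono) auto
        then show "C / (real t + b) powr p \<le> C * b powr (-d) * (1 / real t powr (1 + d))"
          by (simp add: powr_minus field_simps)
      qed
      also have "\<dots> = C * b powr (-d) * (\<Sum>t=1..T. 1 / real t powr (1 + d))"
        by (simp only: sum_distrib_left)
      also have "\<dots> \<le> C * b powr (-d) * S"
        unfolding S_def using C summ by (intro mult_left_mono sum_le_suminf) auto
      also have "\<dots> \<le> \<epsilon>" using elim by (simp add: mult_ac)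
      finally show "(\<Sum>t=1..T. C / (real t + b) powr p) \<le> \<epsilon>" .
    qed
  qed
qed

lemma powr_one_third_cube:
  fixes c :: real
  assumes "c \<ge> 0"
  shows "(c ^ 3) powr (1/3) = c"
proof (cases "c = 0")
  case False
  then have "c ^ 3 = c powr 3" using assms by (simp add: powr_numeral)
  then have "(c ^ 3) powr (1/3) = c powr (3 * (1/3))" by (simp only: powr_powr)
  then show ?thesis using assms by simp
qed simp

lemma dseg_stepsize_products:
  fixes s \<gamma> \<eta> \<rho> q :: real
  assumes s: "s > 0"
  shows "\<eta> / s powr (2/3) * (\<gamma> / s powr (1/3))\<^sup>2 + (\<eta> / s powr (2/3))\<^sup>2
      = (\<eta> * \<gamma>\<^sup>2 + \<eta>\<^sup>2) / s powr (4/3)"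
    and "\<gamma> / s powr (1/3) * (\<eta> / s powr (2/3)) = \<gamma> * \<eta> / s"
    and "(2 * (\<gamma> / s powr (1/3)) / \<rho>) powr q = (2 * \<gamma> / \<rho>) powr q / s powr (q/3)"
proof -
  have sq: "(s powr a)\<^sup>2 = s powr (2 * a)" for a
    using s by (simp add: powr_power mult.commute)
  have "s powr (2/3) * s powr (2/3) = s powr (4/3)" "s powr (1/3) * s powr (2/3) = s"
    using s by (simp_all add: powr_add[symmetric])
  then show "\<eta> / s powr (2/3) * (\<gamma> / s powr (1/3))\<^sup>2 + (\<eta> / s powr (2/3))\<^sup>2
      = (\<eta> * \<gamma>\<^sup>2 + \<eta>\<^sup>2) / s powr (4/3)"
    "\<gamma> / s powr (1/3) * (\<eta> / s powr (2/3)) = \<gamma> * \<eta> / s"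
    by (simp_all add: power_divide sq add_divide_distrib)
  have "2 * (\<gamma> / s powr (1/3)) / \<rho> = (2 * \<gamma> / \<rho>) / s powr (1/3)" by simp
  also have "\<dots> powr q = (2 * \<gamma> / \<rho>) powr q / (s powr (1/3)) powr q"
    by (rule powr_divide)
  also have "(s powr (1/3)) powr q = s powr (q/3)" by (simp add: powr_powr)
  finally show "(2 * (\<gamma> / s powr (1/3)) / \<rho>) powr q = (2 * \<gamma> / \<rho>) powr q / s powr (q/3)" .
qed

section \<open>Histories and conditioning on an event\<close>

lemma space_history [simp]: "space (history M X n) = space M"
  unfolding history_def by (subst space_measure_of) auto

lemma sets_history:
  "sets (history M X n) =
    sigma_sets (space M) {X s -` A \<inter> space M | s A. s \<in> {2..n} \<and> A \<in> sets borel}"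
  unfolding history_def by (subst sets_measure_of) auto

lemma subalgebra_history:
  assumes "\<And>k. k \<ge> 2 \<Longrightarrow> X k \<in> borel_measurable M"
  shows "subalgebra M (history M X n)"
  unfolding subalgebra_def
proof
  show "sets (history M X n) \<subseteq> sets M"
    unfolding sets_history using assms by (intro sets.sigma_sets_subset) (auto intro: measurable_sets)
qed simp

lemma measurable_history:
  assumes "k \<in> {2..n}"
  shows "X k \<in> borel_measurable (history M X n)"
proof (rule measurableI)
  fix A :: "'b set" assume "A \<in> sets borel"
  then show "X k -` A \<inter> space (history M X n) \<in> sets (history M X n)"
    unfolding sets_history space_history using assms by (intro sigma_sets.Basic) blast
qed auto

lemma (in prob_space) uniform_measure_real_density:
  assumes "E \<in> events" "prob E > 0"
  shows "uniform_measure M E = density M (\<lambda>x. ennreal (indicator E x / prob E))"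
  unfolding uniform_measure_def
  by (rule density_cong)
    (use assms in \<open>auto simp: emeasure_eq_measure divide_ennreal[symmetric] split: split_indicator\<close>)

lemma (in prob_space) integrable_uniform_measure:
  fixes f :: "'a \<Rightarrow> real"
  assumes E: "E \<in> events" "prob E > 0" and f: "f \<in> borel_measurable M"
    and int: "integrable M (\<lambda>x. indicator E x * f x)"
  shows "integrable (uniform_measure M E) f"
    and "(\<integral>x. f x \<partial>uniform_measure M E) = (\<integral>x. indicator E x * f x \<partial>M) / prob E"
proof -
  have [measurable]: "E \<in> events" by fact
  have eq: "indicator E x / prob E * f x = indicator E x * f x / prob E" for x by simp
  show "integrable (uniform_measure M E) f"
    unfolding uniform_measure_real_density[OF E]
    by (subst integrable_real_density) (use f int in \<open>auto simp: eq\<close>)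
  show "(\<integral>x. f x \<partial>uniform_measure M E) = (\<integral>x. indicator E x * f x \<partial>M) / prob E"
    unfolding uniform_measure_real_density[OF E]
    by (subst integral_real_density) (use f int in \<open>auto simp: eq\<close>)
qed

section \<open>Noise inside the neighbourhood\<close>

lemma one_plus_powr_ge_square:
  fixes x q :: real
  assumes "x \<ge> 0" "q \<ge> 2"
  shows "x\<^sup>2 \<le> 1 + x powr q"
proof (cases "x \<le> 1")
  case True
  then have "x\<^sup>2 \<le> 1" using assms by (simp add: power_le_one)
  then show ?thesis by (simp add: add_increasing2)
next
  case False
  then have "x powr 2 \<le> x powr q" using assms by (intro powr_mono) auto
  then show ?thesis using False by (simp add: powr_numeral)
qed

text \<open>
  The setting in which the process is followed: \<open>\<rho>\<close> is the radius that confines the integer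
  iterates, the Lipschitz and monotonicity conditions are used on the ball of radius \<open>2 \<rho>\<close> that
  confines the half iterates, \<open>m\<close> comes from the invertible Jacobian, and \<open>U\<close> is the set of admissible
  starting points.  The step sizes are arbitrary here apart from two smallness conditions.
\<close>

locale local_dseg = dseg M V \<gamma> \<eta> X Z
  for M :: "'w measure" and V :: "real ^ 'd \<Rightarrow> real ^ 'd"
    and \<gamma> \<eta> :: "nat \<Rightarrow> real" and X Z :: "nat \<Rightarrow> 'w \<Rightarrow> real ^ 'd" +
  fixes xs :: "real ^ 'd" and U\<^sub>0 U :: "(real ^ 'd) set"
    and L q \<sigma> \<kappa> m \<rho> :: real
  assumes noise: "local_noise M X Z xs U\<^sub>0 q \<sigma> \<kappa>"
    and \<rho>_pos: "\<rho> > 0"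
    and ball_in_U0: "cball xs (2 * \<rho>) \<subseteq> U\<^sub>0"
    and lipschitz: "\<And>x y. x \<in> cball xs (2 * \<rho>) \<Longrightarrow> y \<in> cball xs (2 * \<rho>) \<Longrightarrow>
      norm (V y - V x) \<le> L * norm (y - x)"
    and monotone: "\<And>x. x \<in> cball xs (2 * \<rho>) \<Longrightarrow> V x \<bullet> (x - xs) \<ge> 0"
    and zero: "V xs = 0"
    and expansive: "\<And>x. x \<in> cball xs \<rho> \<Longrightarrow> m * norm (x - xs) \<le> norm (V x)"
    and constants: "L \<ge> 0" "q \<ge> 2" "\<sigma> \<ge> 0" "\<kappa> \<ge> 0" "m \<ge> 0"
    and init: "U \<in> sets borel" "U \<subseteq> cball xs \<rho>"
    and small: "\<And>t. t \<ge> 1 \<Longrightarrow> 3 * (L * \<gamma> t) \<le> 1"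
      "\<And>t. t \<ge> 1 \<Longrightarrow> \<gamma> t * \<eta> t * m\<^sup>2 \<le> 1"
begin

abbreviation \<F> :: "nat \<Rightarrow> 'w measure" where "\<F> n \<equiv> history M X n"

text \<open>
  A common bound for the conditional moments of order \<open>2\<close> and \<open>q\<close> of the noise on the large ball;
  the summand \<open>1\<close> makes it cover both.
\<close>

definition noise_const :: real where "noise_const = 1 + (\<sigma> + \<kappa> * (2 * \<rho>)) powr q"

text \<open>
  The index is the doubled one: even indices are integer iterates, odd ones half iterates.
\<close>

definition good :: "nat \<Rightarrow> 'w set" where
  "good n = {\<omega> \<in> space M. X 2 \<omega> \<in> U \<and>
     (\<forall>k\<in>{2..n}. X k \<omega> \<in> cball xs (if even k then \<rho> else 2 * \<rho>))}"

lemma noise_const_ge_1: "noise_const \<ge> 1" by (simp add: noise_const_def)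

lemma step_pos: "t \<ge> 1 \<Longrightarrow> \<gamma> t > 0" "t \<ge> 1 \<Longrightarrow> \<eta> t > 0"
  using stepsizes[of t] by auto

lemma finite_measure_subalgebra_history: "finite_measure_subalgebra M (\<F> n)"
  using subalgebra_history[of X M n] X_measurable
  by (auto simp: finite_measure_subalgebra_def finite_measure_subalgebra_axioms_def
      intro: finite_measure_axioms)

lemma from_history: "f \<in> borel_measurable (\<F> n) \<Longrightarrow> f \<in> borel_measurable M"
  using measurable_from_subalg subalgebra_history X_measurable by metis

lemma sets_from_history: "A \<in> sets (\<F> n) \<Longrightarrow> A \<in> sets M"
  using subalgebra_history[of X M n] X_measurable by (auto simp: subalgebra_def)

lemma good_in_history:
  assumes "n \<ge> 2" shows "good n \<in> sets (\<F> n)"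
proof -
  have pre: "{\<omega> \<in> space (\<F> n). X k \<omega> \<in> C} \<in> sets (\<F> n)" if "k \<in> {2..n}" "C \<in> sets borel" for k C
    using measurable_sets[OF measurable_history[where X = X and M = M, OF that(1)] that(2)]
    by (simp add: vimage_def Int_def conj_commute)
  have "good n = {\<omega> \<in> space (\<F> n). X 2 \<omega> \<in> U} \<inter>
      {\<omega> \<in> space (\<F> n). \<forall>k\<in>{2..n}. X k \<omega> \<in> cball xs (if even k then \<rho> else 2 * \<rho>)}"
    by (auto simp: good_def)
  also have "\<dots> \<in> sets (\<F> n)"
    using assms init(1) by (intro sets.Int sets.sets_Collect_finite_All pre) auto
  finally show ?thesis .
qed

lemma good_events [measurable]: "n \<ge> 2 \<Longrightarrow> good n \<in> sets M"
  using good_in_history sets_from_history by blast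

lemma good_antimono: "k \<le> n \<Longrightarrow> good n \<subseteq> good k"
  unfolding good_def by auto

lemma goodD: "\<omega> \<in> good n \<Longrightarrow> n \<ge> 2 \<Longrightarrow> X n \<omega> \<in> cball xs (if even n then \<rho> else 2 * \<rho>)"
  by (auto simp: good_def)

lemma good_in_double_ball: "\<omega> \<in> good n \<Longrightarrow> n \<ge> 2 \<Longrightarrow> X n \<omega> \<in> cball xs (2 * \<rho>)"
  using goodD[of \<omega> n] \<rho>_pos by (auto split: if_splits)

lemma good_2: "good 2 = {\<omega> \<in> space M. X 2 \<omega> \<in> U}"
  using init by (auto simp: good_def)

lemma good_Suc:
  "n \<ge> 2 \<Longrightarrow> good (Suc n) =
    {\<omega> \<in> good n. X (Suc n) \<omega> \<in> cball xs (if even (Suc n) then \<rho> else 2 * \<rho>)}"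
  unfolding good_def by (auto simp only: atLeastAtMostSuc_conv le_SucI Ball_def insert_iff mem_Collect_eq)

lemma integrable_indicator_event [simp]: "A \<in> sets M \<Longrightarrow> integrable M (indicat_real A)"
  by (rule integrable_real_indicator) (auto simp: less_top[symmetric])

text \<open>
  The noise has moments only where the iterate lies in the neighbourhood, so integrability is
  obtained on events of the history that are contained in that set.
\<close>

lemma noise_moment:
  assumes n: "n \<ge> 2" and A: "A \<in> sets (\<F> n)"
    and sub: "\<And>\<omega>. \<omega> \<in> A \<Longrightarrow> X n \<omega> \<in> cball xs (2 * \<rho>)"
  shows "integrable M (\<lambda>\<omega>. indicator A \<omega> * norm (Z n \<omega>) powr q)"
    and "(\<integral>\<omega>. indicator A \<omega> * norm (Z n \<omega>) powr q \<partial>M)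
      \<le> (\<sigma> + \<kappa> * (2 * \<rho>)) powr q * prob A"
proof -
  interpret finite_measure_subalgebra M "\<F> n" by (rule finite_measure_subalgebra_history)
  have [measurable]: "A \<in> sets (\<F> n)" "A \<in> sets M" using A sets_from_history by auto
  have [measurable]: "Z n \<in> borel_measurable M" using Z_measurable n by auto
  define c where "c = (\<sigma> + \<kappa> * (2 * \<rho>)) powr q"
  have "(\<integral>\<^sup>+\<omega>. ennreal (indicator A \<omega> * norm (Z n \<omega>) powr q) \<partial>M)
      = (\<integral>\<^sup>+\<omega>. indicator A \<omega> * ennreal (norm (Z n \<omega>) powr q) \<partial>M)"
    by (intro nn_integral_cong) (auto split: split_indicator)
  also have "\<dots> = (\<integral>\<^sup>+\<omega>. indicator A \<omega> *
      nn_cond_exp M (\<F> n) (\<lambda>\<omega>'. ennreal (norm (Z n \<omega>') powr q)) \<omega> \<partial>M)"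
    by (intro nn_cond_exp_intg[symmetric]) measurable
  also have "\<dots> \<le> (\<integral>\<^sup>+\<omega>. ennreal c * indicator A \<omega> \<partial>M)"
  proof (rule nn_integral_mono_AE)
    have "AE \<omega> in M. nn_cond_exp M (\<F> n) (\<lambda>\<omega>'. ennreal (norm (Z n \<omega>') powr q)) \<omega>
            * indicator U\<^sub>0 (X n \<omega>) \<le> ennreal ((\<sigma> + \<kappa> * norm (X n \<omega> - xs)) powr q)"
      using noise n by (auto simp: local_noise_def)
    then show "AE \<omega> in M. indicator A \<omega> *
      nn_cond_exp M (\<F> n) (\<lambda>\<omega>'. ennreal (norm (Z n \<omega>') powr q)) \<omega> \<le> ennreal c * indicator A \<omega>"
    proof eventually_elim
      case (elim \<omega>)
      show ?case
      proof (cases "\<omega> \<in> A")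
        case True
        then have X: "X n \<omega> \<in> cball xs (2 * \<rho>)" using sub by blast
        then have "norm (X n \<omega> - xs) \<le> 2 * \<rho>" by (simp add: dist_norm norm_minus_commute)
        then have "(\<sigma> + \<kappa> * norm (X n \<omega> - xs)) powr q \<le> c"
          unfolding c_def using constants
          by (intro powr_mono2 add_left_mono mult_left_mono) auto
        moreover have "X n \<omega> \<in> U\<^sub>0" using X ball_in_U0 by blast
        ultimately show ?thesis using elim True by (auto intro: order_trans ennreal_leI)
      qed auto
    qed
  qed
  also have "\<dots> = ennreal (c * prob A)"
    by (simp add: nn_integral_cmult emeasure_eq_measure ennreal_mult' c_def)
  finally have *: "(\<integral>\<^sup>+\<omega>. ennreal (indicator A \<omega> * norm (Z n \<omega>) powr q) \<partial>M) \<le> ennreal (c * prob A)" .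
  show int: "integrable M (\<lambda>\<omega>. indicator A \<omega> * norm (Z n \<omega>) powr q)"
    using * by (intro integrableI_nonneg) (auto simp: le_less_trans[OF _ ennreal_less_top])
  show "(\<integral>\<omega>. indicator A \<omega> * norm (Z n \<omega>) powr q \<partial>M) \<le> (\<sigma> + \<kappa> * (2 * \<rho>)) powr q * prob A"
    using * unfolding c_def[symmetric]
    by (subst (asm) nn_integral_eq_integral[OF int]) (auto simp: c_def)
qed

lemma noise_second_moment:
  assumes n: "n \<ge> 2" and A: "A \<in> sets (\<F> n)"
    and sub: "\<And>\<omega>. \<omega> \<in> A \<Longrightarrow> X n \<omega> \<in> cball xs (2 * \<rho>)"
  shows "integrable M (\<lambda>\<omega>. indicator A \<omega> * (norm (Z n \<omega>))\<^sup>2)"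
    and "(\<integral>\<omega>. indicator A \<omega> * (norm (Z n \<omega>))\<^sup>2 \<partial>M) \<le> noise_const * prob A"
proof -
  note mom = noise_moment[OF n A sub]
  have [measurable]: "A \<in> sets M" using A sets_from_history by auto
  have [measurable]: "Z n \<in> borel_measurable M" using Z_measurable n by auto
  have le: "indicator A \<omega> * (norm (Z n \<omega>))\<^sup>2 \<le> indicator A \<omega> + indicator A \<omega> * norm (Z n \<omega>) powr q" for \<omega>
    using one_plus_powr_ge_square[of "norm (Z n \<omega>)" q] constants by (auto split: split_indicator)
  have intr: "integrable M (\<lambda>\<omega>. indicator A \<omega> + indicator A \<omega> * norm (Z n \<omega>) powr q)"
    using mom(1) by (intro Bochner_Integration.integrable_add) auto
  show int: "integrable M (\<lambda>\<omega>. indicator A \<omega> * (norm (Z n \<omega>))\<^sup>2)"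
    by (rule Bochner_Integration.integrable_bound[OF intr])
      (auto intro!: AE_I2 simp: le abs_of_nonneg add_nonneg_nonneg)
  have "(\<integral>\<omega>. indicator A \<omega> * (norm (Z n \<omega>))\<^sup>2 \<partial>M)
      \<le> (\<integral>\<omega>. indicator A \<omega> + indicator A \<omega> * norm (Z n \<omega>) powr q \<partial>M)"
    using int intr le by (intro integral_mono) auto
  also have "\<dots> = prob A + (\<integral>\<omega>. indicator A \<omega> * norm (Z n \<omega>) powr q \<partial>M)"
    using mom(1) by (subst Bochner_Integration.integral_add) auto
  also have "\<dots> \<le> noise_const * prob A"
    using mom(2) by (simp add: noise_const_def algebra_simps)
  finally show "(\<integral>\<omega>. indicator A \<omega> * (norm (Z n \<omega>))\<^sup>2 \<partial>M) \<le> noise_const * prob A" .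
qed

text \<open>
  \<open>Z n\<close> need not be integrable globally.  Coordinate by coordinate it suffices that the product
  with \<open>f\<close> is integrable: then \<open>f\<close> can be paired with the conditional expectation instead, which
  vanishes wherever \<open>f\<close> does not.
\<close>

lemma noise_orthogonal:
  fixes f :: "'w \<Rightarrow> real ^ 'd"
  assumes n: "n \<ge> 2" and A: "A \<in> sets (\<F> n)"
    and sub: "\<And>\<omega>. \<omega> \<in> A \<Longrightarrow> X n \<omega> \<in> cball xs (2 * \<rho>)"
    and f: "f \<in> borel_measurable (\<F> n)" and bound: "\<And>\<omega>. norm (f \<omega>) \<le> C * indicator A \<omega>"
  shows "integrable M (\<lambda>\<omega>. f \<omega> \<bullet> Z n \<omega>)" and "(\<integral>\<omega>. f \<omega> \<bullet> Z n \<omega> \<partial>M) = 0"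
proof -
  interpret finite_measure_subalgebra M "\<F> n" by (rule finite_measure_subalgebra_history)
  have [measurable]: "A \<in> sets M" using A sets_from_history by auto
  have Zm [measurable]: "Z n \<in> borel_measurable M" using Z_measurable n by auto
  have fm [measurable]: "f \<in> borel_measurable M" using f from_history by blast
  have fi: "(\<lambda>\<omega>. f \<omega> $ i) \<in> borel_measurable (\<F> n)" for i
    by (rule measurable_compose[OF f]) (intro borel_measurable_continuous_onI continuous_intros)
  have fiM [measurable]: "(\<lambda>\<omega>. f \<omega> $ i) \<in> borel_measurable M" for i
    using fi from_history by blast
  have Zi [measurable]: "(\<lambda>\<omega>. Z n \<omega> $ i) \<in> borel_measurable M" for i
    by (rule measurable_compose[OF Zm]) (intro borel_measurable_continuous_onI continuous_intros)
  have cond [measurable]: "real_cond_exp M (\<F> n) g \<in> borel_measurable M" for g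
    using borel_measurable_cond_exp from_history by blast
  have intr: "integrable M (\<lambda>\<omega>. C * (indicator A \<omega> + indicator A \<omega> * (norm (Z n \<omega>))\<^sup>2))"
    using noise_second_moment(1)[OF n A sub] by (intro integrable_mult_right Bochner_Integration.integrable_add) auto
  have int: "integrable M (\<lambda>\<omega>. f \<omega> $ i * Z n \<omega> $ i)" for i
  proof (rule Bochner_Integration.integrable_bound[OF intr])
    show "AE \<omega> in M. norm (f \<omega> $ i * Z n \<omega> $ i)
        \<le> norm (C * (indicator A \<omega> + indicator A \<omega> * (norm (Z n \<omega>))\<^sup>2))"
    proof (rule AE_I2)
      fix \<omega>
      have "norm (f \<omega> $ i * Z n \<omega> $ i) \<le> norm (f \<omega>) * norm (Z n \<omega>)"
        by (simp add: abs_mult mult_mono component_le_norm_cart)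
      also have "\<dots> \<le> C * indicator A \<omega> * norm (Z n \<omega>)"
        using bound by (intro mult_right_mono) auto
      also have "\<dots> \<le> C * indicator A \<omega> * (1 + (norm (Z n \<omega>))\<^sup>2)"
      proof (rule mult_left_mono)
        show "norm (Z n \<omega>) \<le> 1 + (norm (Z n \<omega>))\<^sup>2"
          using sum_squares_bound[of 1 "norm (Z n \<omega>)"] norm_ge_zero[of "Z n \<omega>"]
          unfolding one_power2 mult_1_right by linarith
        show "0 \<le> C * indicator A \<omega>" using bound[of \<omega>] norm_ge_zero order_trans by blast
      qed
      also have "\<dots> \<le> norm \<dots>" by simp
      finally show "norm (f \<omega> $ i * Z n \<omega> $ i)
        \<le> norm (C * (indicator A \<omega> + indicator A \<omega> * (norm (Z n \<omega>))\<^sup>2))"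
        by (simp add: algebra_simps)
    qed
  qed (intro borel_measurable_times fiM Zi)
  have mean: "(\<integral>\<omega>. f \<omega> $ i * Z n \<omega> $ i \<partial>M) = 0" for i
  proof -
    have "(\<integral>\<omega>. f \<omega> $ i * Z n \<omega> $ i \<partial>M)
        = (\<integral>\<omega>. f \<omega> $ i * real_cond_exp M (\<F> n) (\<lambda>\<omega>. Z n \<omega> $ i) \<omega> \<partial>M)"
      using real_cond_exp_intg(2)[OF int fi Zi] by simp
    also have "\<dots> = (\<integral>\<omega>. 0 \<partial>M)"
    proof (rule integral_cong_AE)
      have "AE \<omega> in M. indicat_real U\<^sub>0 (X n \<omega>) *\<^sub>R vec_cond_exp M (\<F> n) (Z n) \<omega> = 0"
        using noise n by (auto simp: local_noise_def)
      then show "AE \<omega> in M. f \<omega> $ i * real_cond_exp M (\<F> n) (\<lambda>\<omega>. Z n \<omega> $ i) \<omega> = 0"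
      proof eventually_elim
        case (elim \<omega>)
        show ?case
        proof (cases "\<omega> \<in> A")
          case True
          then have "X n \<omega> \<in> U\<^sub>0" using sub ball_in_U0 by blast
          with elim have "vec_cond_exp M (\<F> n) (Z n) \<omega> = 0" by simp
          then show ?thesis by (simp add: vec_cond_exp_def vec_eq_iff)
        next
          case False
          then have "f \<omega> = 0" using bound[of \<omega>] by simp
          then show ?thesis by simp
        qed
      qed
    qed (auto intro!: borel_measurable_times fiM cond)
    finally show ?thesis by simp
  qed
  have eq: "f \<omega> \<bullet> Z n \<omega> = (\<Sum>i\<in>UNIV. f \<omega> $ i * Z n \<omega> $ i)" for \<omega>
    by (simp add: inner_vec_def)
  show "integrable M (\<lambda>\<omega>. f \<omega> \<bullet> Z n \<omega>)"
    unfolding eq using int by (intro Bochner_Integration.integrable_sum)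
  show "(\<integral>\<omega>. f \<omega> \<bullet> Z n \<omega> \<partial>M) = 0"
    unfolding eq using int mean by (subst Bochner_Integration.integral_sum) auto
qed

section \<open>Leaving the large ball at a half step\<close>

lemma continuous_V: "continuous_on (cball xs (2 * \<rho>)) V"
  using lipschitz constants
  by (intro lipschitz_on_continuous_on[of L] lipschitz_onI) (auto simp: dist_norm norm_minus_commute)

lemma norm_V_le: "x \<in> cball xs (2 * \<rho>) \<Longrightarrow> norm (V x) \<le> L * norm (x - xs)"
  using lipschitz[of xs x] \<rho>_pos zero by simp

text \<open>
  A gap of \<open>\<rho> / 2\<close> to the large sphere remains, which only the noise can bridge.
\<close>

lemma noiseless_half_step:
  assumes t: "t \<ge> 1" and x: "x \<in> cball xs \<rho>"
  shows "norm (x - \<gamma> t *\<^sub>R V x - xs) \<le> 3 / 2 * \<rho>"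
proof -
  have r: "norm (x - xs) \<le> \<rho>" using x by (simp add: dist_norm norm_minus_commute)
  have "norm (\<gamma> t *\<^sub>R V x) \<le> \<gamma> t * (L * \<rho>)"
    using norm_V_le[of x] x \<rho>_pos step_pos(1)[OF t] constants mult_left_mono[OF r, of L] by simp
  also have "\<dots> \<le> \<rho> / 2"
    using mult_right_mono[OF small(1)[OF t], of \<rho>] \<rho>_pos by (simp add: mult_ac)
  finally have "norm (\<gamma> t *\<^sub>R V x) \<le> \<rho> / 2" .
  then show ?thesis
    using r norm_triangle_ineq4[of "x - xs" "\<gamma> t *\<^sub>R V x"] by (simp add: algebra_simps)
qed

lemma noiseless_half_step_in_ball:
  "t \<ge> 1 \<Longrightarrow> x \<in> cball xs \<rho> \<Longrightarrow> x - \<gamma> t *\<^sub>R V x \<in> cball xs (2 * \<rho>)"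
  using noiseless_half_step[of t x] \<rho>_pos by (simp add: dist_norm norm_minus_commute[of xs])

lemma large_noise_of_half_step_exit:
  assumes t: "t \<ge> 1" and \<omega>: "\<omega> \<in> good (2 * t) - good (2 * t + 1)"
  shows "\<rho> \<le> 2 * \<gamma> t * norm (Z (2 * t) \<omega>)"
proof -
  have sp: "\<omega> \<in> space M" using \<omega> by (auto simp: good_def)
  have x: "X (2 * t) \<omega> \<in> cball xs \<rho>" using goodD[of \<omega> "2 * t"] \<omega> t by auto
  have "X (2 * t + 1) \<omega> \<notin> cball xs (2 * \<rho>)"
    using \<omega> t good_Suc[of "2 * t"] by auto
  then have "2 * \<rho> < norm (X (2 * t + 1) \<omega> - xs)"
    by (simp add: dist_norm norm_minus_commute)
  also have "X (2 * t + 1) \<omega> - xs =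
      (X (2 * t) \<omega> - \<gamma> t *\<^sub>R V (X (2 * t) \<omega>) - xs) - \<gamma> t *\<^sub>R Z (2 * t) \<omega>"
    unfolding extrapolation[OF t sp] by (simp add: scaleR_add_right)
  also have "norm \<dots> \<le> 3 / 2 * \<rho> + \<gamma> t * norm (Z (2 * t) \<omega>)"
    using norm_triangle_ineq4[of "X (2 * t) \<omega> - \<gamma> t *\<^sub>R V (X (2 * t) \<omega>) - xs" "\<gamma> t *\<^sub>R Z (2 * t) \<omega>"]
      noiseless_half_step[OF t x] step_pos[OF t] by simp
  finally show ?thesis by simp
qed

text \<open>
  Markov's inequality of order \<open>q\<close>: leaving the large ball requires \<open>2 \<gamma>\<^sub>t \<parallel>Z\<parallel> / \<rho> \<ge> 1\<close>.
\<close>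

lemma prob_half_step_exit:
  assumes t: "t \<ge> 1"
  shows "prob (good (2 * t) - good (2 * t + 1)) \<le> noise_const * (2 * \<gamma> t / \<rho>) powr q * prob (good 2)"
proof -
  let ?A = "good (2 * t)" and ?B = "good (2 * t + 1)" and ?c = "(2 * \<gamma> t / \<rho>) powr q"
  have ev [measurable]: "?A \<in> sets M" "?B \<in> sets M" using t good_events by auto
  note mom = noise_moment[of "2 * t" ?A, OF _ good_in_history good_in_double_ball]
  have "prob (?A - ?B) = (\<integral>\<omega>. indicator (?A - ?B) \<omega> \<partial>M)"
    using ev sets.sets_into_space[of "?A - ?B" M] by (simp add: Int_absorb2)
  also have "\<dots> \<le> (\<integral>\<omega>. ?c * (indicator ?A \<omega> * norm (Z (2 * t) \<omega>) powr q) \<partial>M)"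
  proof (rule integral_mono)
    show "integrable M (\<lambda>\<omega>. ?c * (indicator ?A \<omega> * norm (Z (2 * t) \<omega>) powr q))"
      using mom(1) t by simp
    fix \<omega>
    show "indicator (?A - ?B) \<omega> \<le> ?c * (indicator ?A \<omega> * norm (Z (2 * t) \<omega>) powr q)"
    proof (cases "\<omega> \<in> ?A - ?B")
      case True
      have "1 \<le> 2 * \<gamma> t / \<rho> * norm (Z (2 * t) \<omega>)"
        using large_noise_of_half_step_exit[OF t True] \<rho>_pos by (simp add: field_simps)
      then have "1 \<le> (2 * \<gamma> t / \<rho> * norm (Z (2 * t) \<omega>)) powr q"
        using constants by (simp add: ge_one_powr_ge_zero)
      also have "\<dots> = ?c * norm (Z (2 * t) \<omega>) powr q"
        by (rule powr_mult)
      finally show ?thesis using True by simp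
    qed simp
  qed (use ev in simp)
  also have "\<dots> = ?c * (\<integral>\<omega>. indicator ?A \<omega> * norm (Z (2 * t) \<omega>) powr q \<partial>M)" by simp
  also have "\<dots> \<le> ?c * (noise_const * prob ?A)"
  proof (rule mult_left_mono)
    have "(\<integral>\<omega>. indicator ?A \<omega> * norm (Z (2 * t) \<omega>) powr q \<partial>M)
        \<le> (\<sigma> + \<kappa> * (2 * \<rho>)) powr q * prob ?A" using mom(2) t by simp
    also have "\<dots> \<le> noise_const * prob ?A" by (intro mult_right_mono) (auto simp: noise_const_def)
    finally show "(\<integral>\<omega>. indicator ?A \<omega> * norm (Z (2 * t) \<omega>) powr q \<partial>M) \<le> noise_const * prob ?A" .
  qed simp
  also have "\<dots> \<le> ?c * (noise_const * prob (good 2))"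
    using noise_const_ge_1 t good_antimono[of 2 "2 * t"] good_events
    by (intro mult_left_mono finite_measure_mono) auto
  finally show ?thesis by (simp add: mult_ac)
qed

section \<open>The drift inequality\<close>

text \<open>
  The operator at the noiseless half iterate, cut off to the good event of the integer time; it is
  a function of the history before \<open>Z (2 * t)\<close> is drawn.
\<close>

definition probe :: "nat \<Rightarrow> 'w \<Rightarrow> real ^ 'd" where
  "probe t \<omega> = indicat_real (good (2 * t)) \<omega> *\<^sub>R V (X (2 * t) \<omega> - \<gamma> t *\<^sub>R V (X (2 * t) \<omega>))"

text \<open>
  \<open>V\<close> may fail to be Borel measurable away from the ball, so the cut-off is moved inside: on the good
  event the iterate lies in a closed ball on which the composed map is continuous.
\<close>

lemma measurable_probe:
  assumes "t \<ge> 1" shows "probe t \<in> borel_measurable (\<F> (2 * t))"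
proof -
  define \<phi> where "\<phi> x = V (x - \<gamma> t *\<^sub>R V x)" for x
  have "continuous_on (cball xs \<rho>) V"
    using continuous_V by (rule continuous_on_subset) (use \<rho>_pos in auto)
  then have "continuous_on (cball xs \<rho>) \<phi>"
    unfolding \<phi>_def using noiseless_half_step_in_ball[OF assms] \<rho>_pos
    by (intro continuous_on_compose2[OF continuous_V] continuous_intros) auto
  then have "(\<lambda>x. indicat_real (cball xs \<rho>) x *\<^sub>R \<phi> x) \<in> borel_measurable borel"
    by (intro borel_measurable_continuous_on_indicator) auto
  moreover have "X (2 * t) \<in> borel_measurable (\<F> (2 * t))"
    using assms by (intro measurable_history) auto
  ultimately have "(\<lambda>\<omega>. indicat_real (cball xs \<rho>) (X (2 * t) \<omega>) *\<^sub>R \<phi> (X (2 * t) \<omega>))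
      \<in> borel_measurable (\<F> (2 * t))"
    by (rule measurable_compose[rotated])
  moreover have "indicat_real (good (2 * t)) \<in> borel_measurable (\<F> (2 * t))"
    using good_in_history assms by (intro borel_measurable_indicator) auto
  ultimately have "(\<lambda>\<omega>. indicat_real (good (2 * t)) \<omega> *\<^sub>R
      (indicat_real (cball xs \<rho>) (X (2 * t) \<omega>) *\<^sub>R \<phi> (X (2 * t) \<omega>))) \<in> borel_measurable (\<F> (2 * t))"
    by (rule borel_measurable_scaleR[rotated])
  also have "(\<lambda>\<omega>. indicat_real (good (2 * t)) \<omega> *\<^sub>R
      (indicat_real (cball xs \<rho>) (X (2 * t) \<omega>) *\<^sub>R \<phi> (X (2 * t) \<omega>))) = probe t"
    using goodD[of _ "2 * t"] assms
    by (auto simp: probe_def \<phi>_def fun_eq_iff split: split_indicator)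
  finally show ?thesis .
qed

lemma norm_probe_le:
  assumes "t \<ge> 1"
  shows "norm (probe t \<omega>) \<le> 2 * L * \<rho> * indicator (good (2 * t)) \<omega>"
proof (cases "\<omega> \<in> good (2 * t)")
  case True
  then have x: "X (2 * t) \<omega> \<in> cball xs \<rho>" using goodD[of \<omega> "2 * t"] assms by auto
  let ?y = "X (2 * t) \<omega> - \<gamma> t *\<^sub>R V (X (2 * t) \<omega>)"
  have y: "?y \<in> cball xs (2 * \<rho>)" using noiseless_half_step_in_ball[OF assms x] .
  have "norm (V ?y) \<le> L * norm (?y - xs)" using norm_V_le[OF y] .
  also have "\<dots> \<le> L * (2 * \<rho>)"
    using y constants by (intro mult_left_mono) (auto simp: dist_norm norm_minus_commute)
  finally show ?thesis using True by (simp add: probe_def mult_ac)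
qed (simp add: probe_def)

text \<open>
  The cut-offs are chosen so that both inner products are noise against a factor from its history:
  the one with \<open>Z (2 * t + 1)\<close> carries the indicator of \<open>good (2 * t + 1)\<close>, the one with \<open>Z (2 * t)\<close>
  that of the larger event \<open>good (2 * t)\<close>.  On the difference of the two events the step inequality
  is unavailable and the second product has to be paid for; there the noise is large, which accounts
  for \<open>8\<close> of the constant \<open>11\<close>, the other \<open>3\<close> coming from the step itself.
\<close>

lemma drift_pointwise:
  assumes t: "t \<ge> 1"
  shows "\<rho>\<^sup>2 * indicator (good (2 * t + 1) - good (2 * t + 2)) \<omega>
      + indicator (good (2 * t + 2)) \<omega> * (norm (X (2 * t + 2) \<omega> - xs))\<^sup>2
    \<le> (1 - \<gamma> t * \<eta> t * m\<^sup>2) * (indicator (good (2 * t)) \<omega> * (norm (X (2 * t) \<omega> - xs))\<^sup>2)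
      - 2 * \<eta> t * ((indicat_real (good (2 * t + 1)) \<omega> *\<^sub>R (X (2 * t) \<omega> - xs)) \<bullet> Z (2 * t + 1) \<omega>)
      - 2 * \<eta> t * \<gamma> t * (probe t \<omega> \<bullet> Z (2 * t) \<omega>)
      + 11 * L * \<eta> t * (\<gamma> t)\<^sup>2 * (indicator (good (2 * t)) \<omega> * (norm (Z (2 * t) \<omega>))\<^sup>2)
      + (\<eta> t)\<^sup>2 * (8 * L\<^sup>2 * \<rho>\<^sup>2 * indicator (good (2 * t)) \<omega>
        + 2 * (indicator (good (2 * t + 1)) \<omega> * (norm (Z (2 * t + 1) \<omega>))\<^sup>2))"
    (is "?lhs \<le> ?rhs")
proof -
  define A B A' where "A = good (2 * t)" and "B = good (2 * t + 1)" and "A' = good (2 * t + 2)"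
  define x y z z' where "x = X (2 * t) \<omega>" and "y = X (2 * t + 1) \<omega>"
    and "z = Z (2 * t) \<omega>" and "z' = Z (2 * t + 1) \<omega>"
  define g h where "g = \<gamma> t" and "h = \<eta> t"
  have gh: "g > 0" "h > 0" using step_pos[OF t] by (auto simp: g_def h_def)
  have sub: "B \<subseteq> A" "A' \<subseteq> B" unfolding A_def B_def A'_def by (intro good_antimono; simp)+
  have shrink: "0 \<le> 1 - g * h * m\<^sup>2" using small(2)[OF t] by (simp add: g_def h_def)
  have nn: "0 \<le> L * h * g\<^sup>2 * (norm z)\<^sup>2" "0 \<le> h\<^sup>2 * (8 * L\<^sup>2 * \<rho>\<^sup>2)"
    using gh constants by auto
  consider "\<omega> \<notin> A" | "\<omega> \<in> A" "\<omega> \<notin> B" | "\<omega> \<in> B" by blast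
  then show ?thesis
  proof cases
    case 1
    then have "\<omega> \<notin> B" "\<omega> \<notin> A'" using sub by auto
    with 1 show ?thesis by (simp add: A_def B_def A'_def probe_def)
  next
    case 2
    then have nB: "\<omega> \<notin> A'" using sub by auto
    have \<rho>z: "\<rho> \<le> 2 * g * norm z"
      using large_noise_of_half_step_exit[OF t] 2 by (auto simp: A_def B_def g_def z_def)
    have "probe t \<omega> \<bullet> z \<le> norm (probe t \<omega>) * norm z" by (rule norm_cauchy_schwarz)
    also have "\<dots> \<le> 2 * L * \<rho> * norm z"
      using norm_probe_le[OF t, of \<omega>] 2 by (intro mult_right_mono) (auto simp: A_def)
    also have "\<dots> \<le> 2 * L * (2 * g * norm z) * norm z"
      using \<rho>z constants by (intro mult_right_mono mult_left_mono) auto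
    finally have "probe t \<omega> \<bullet> z \<le> 4 * L * g * (norm z)\<^sup>2" by (simp add: power2_eq_square mult_ac)
    then have "2 * h * g * (probe t \<omega> \<bullet> z) \<le> 2 * h * g * (4 * L * g * (norm z)\<^sup>2)"
      using gh by (intro mult_left_mono) auto
    then have "2 * h * g * (probe t \<omega> \<bullet> z) \<le> 8 * (L * h * g\<^sup>2 * (norm z)\<^sup>2)"
      by (simp add: power2_eq_square mult_ac)
    moreover have "0 \<le> (1 - g * h * m\<^sup>2) * (norm (x - xs))\<^sup>2" using shrink by simp
    moreover have "?rhs = (1 - g * h * m\<^sup>2) * (norm (x - xs))\<^sup>2 - 2 * h * g * (probe t \<omega> \<bullet> z)
        + 11 * (L * h * g\<^sup>2 * (norm z)\<^sup>2) + h\<^sup>2 * (8 * L\<^sup>2 * \<rho>\<^sup>2)"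
      using 2 nB by (simp add: A_def B_def A'_def g_def h_def x_def z_def)
    moreover have "?lhs = 0" using 2 nB by (simp add: A_def B_def A'_def)
    ultimately show ?thesis using nn by linarith
  next
    case 3
    then have A: "\<omega> \<in> A" using sub by blast
    have sp: "\<omega> \<in> space M" using A by (auto simp: A_def good_def)
    have x: "x \<in> cball xs \<rho>" using goodD[of \<omega> "2 * t"] A t by (auto simp: A_def x_def)
    have y: "y \<in> cball xs (2 * \<rho>)" using goodD[of \<omega> "2 * t + 1"] 3 t by (auto simp: B_def y_def)
    have y_eq: "y = x - g *\<^sub>R (V x + z)" using extrapolation[OF t sp] by (simp add: y_def x_def g_def z_def)
    have x'_eq: "X (2 * t + 2) \<omega> = x - h *\<^sub>R (V y + z')"
      using update[OF t sp] by (simp add: y_def x_def h_def z'_def)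
    have step: "(norm (X (2 * t + 2) \<omega> - xs))\<^sup>2 + g * h * (norm (V x))\<^sup>2
      \<le> (norm (x - xs))\<^sup>2 - 2 * h * ((x - xs) \<bullet> z') - 2 * h * g * (V (x - g *\<^sub>R V x) \<bullet> z)
        + 3 * L * h * g\<^sup>2 * (norm z)\<^sup>2 + h\<^sup>2 * (8 * L\<^sup>2 * \<rho>\<^sup>2 + 2 * (norm z')\<^sup>2)"
      unfolding x'_eq
      by (rule extragradient_step[OF lipschitz monotone zero x y_eq y])
        (use gh constants small(1)[OF t] noiseless_half_step_in_ball[OF t x] in \<open>auto simp: g_def\<close>)
    have "(m * norm (x - xs))\<^sup>2 \<le> (norm (V x))\<^sup>2"
      using expansive[OF x] constants by (intro power_mono) auto
    then have "g * h * (m * norm (x - xs))\<^sup>2 \<le> g * h * (norm (V x))\<^sup>2"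
      using gh by (intro mult_left_mono) auto
    then have low: "g * h * m\<^sup>2 * (norm (x - xs))\<^sup>2 \<le> g * h * (norm (V x))\<^sup>2"
      by (simp add: power_mult_distrib mult_ac)
    have "?lhs \<le> (norm (X (2 * t + 2) \<omega> - xs))\<^sup>2"
    proof (cases "\<omega> \<in> A'")
      case False
      then have "X (2 * t + 2) \<omega> \<notin> cball xs \<rho>"
        using 3 t good_Suc[of "2 * t + 1"] by (auto simp: A'_def B_def)
      then have "\<rho> \<le> norm (X (2 * t + 2) \<omega> - xs)"
        by (simp add: dist_norm norm_minus_commute)
      then have "\<rho>\<^sup>2 \<le> (norm (X (2 * t + 2) \<omega> - xs))\<^sup>2"
        using \<rho>_pos by (intro power_mono) auto
      then show ?thesis using False by (simp add: A'_def indicator_def)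
    qed (simp add: A'_def)
    moreover have "?rhs = (1 - g * h * m\<^sup>2) * (norm (x - xs))\<^sup>2 - 2 * h * ((x - xs) \<bullet> z')
        - 2 * h * g * (V (x - g *\<^sub>R V x) \<bullet> z) + 11 * (L * h * g\<^sup>2 * (norm z)\<^sup>2)
        + h\<^sup>2 * (8 * L\<^sup>2 * \<rho>\<^sup>2 + 2 * (norm z')\<^sup>2)"
      using 3 A by (simp add: A_def B_def g_def h_def x_def z_def z'_def probe_def)
    moreover have "(1 - g * h * m\<^sup>2) * (norm (x - xs))\<^sup>2
        = (norm (x - xs))\<^sup>2 - g * h * m\<^sup>2 * (norm (x - xs))\<^sup>2"
      by (simp add: left_diff_distrib)
    moreover have "3 * L * h * g\<^sup>2 * (norm z)\<^sup>2 = 3 * (L * h * g\<^sup>2 * (norm z)\<^sup>2)" by simp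
    ultimately show ?thesis using step low nn by linarith
  qed
qed

text \<open>
  The expectation is over the good event and is not divided by its probability.
\<close>

definition sq_err :: "nat \<Rightarrow> real" where
  "sq_err t = (\<integral>\<omega>. indicator (good (2 * t)) \<omega> * (norm (X (2 * t) \<omega> - xs))\<^sup>2 \<partial>M)"

definition drift_const :: real where "drift_const = 11 * L * noise_const + 8 * L\<^sup>2 * \<rho>\<^sup>2 + 2 * noise_const"

lemma integrable_sq_err:
  assumes "t \<ge> 1" "C \<in> sets M" "C \<subseteq> good (2 * t)"
  shows "integrable M (\<lambda>\<omega>. indicat_real C \<omega> * (norm (X (2 * t) \<omega> - xs))\<^sup>2)"
proof (rule integrable_const_bound[where B = "\<rho>\<^sup>2"])
  have [measurable]: "X (2 * t) \<in> borel_measurable M" using X_measurable assms by auto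
  have [measurable]: "C \<in> sets M" by fact
  show "(\<lambda>\<omega>. indicat_real C \<omega> * (norm (X (2 * t) \<omega> - xs))\<^sup>2) \<in> borel_measurable M"
    by measurable
  show "AE \<omega> in M. norm (indicat_real C \<omega> * (norm (X (2 * t) \<omega> - xs))\<^sup>2) \<le> \<rho>\<^sup>2"
  proof (rule AE_I2)
    fix \<omega>
    show "norm (indicat_real C \<omega> * (norm (X (2 * t) \<omega> - xs))\<^sup>2) \<le> \<rho>\<^sup>2"
    proof (cases "\<omega> \<in> C")
      case True
      then have "norm (X (2 * t) \<omega> - xs) \<le> \<rho>"
        using goodD[of \<omega> "2 * t"] assms by (auto simp: dist_norm norm_minus_commute)
      then show ?thesis using True by (simp add: power_mono)
    qed simp
  qed
qed

text \<open>
  This one inequality serves twice.  Dropping the exit probability gives the recursion for the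
  rate; dropping the contraction and telescoping bounds all the exit probabilities at once.
\<close>

lemma drift:
  assumes t: "t \<ge> 1"
  shows "\<rho>\<^sup>2 * prob (good (2 * t + 1) - good (2 * t + 2)) + sq_err (Suc t)
    \<le> (1 - \<gamma> t * \<eta> t * m\<^sup>2) * sq_err t + drift_const * (\<eta> t * (\<gamma> t)\<^sup>2 + (\<eta> t)\<^sup>2) * prob (good 2)"
proof -
  define A B A' where "A = good (2 * t)" and "B = good (2 * t + 1)" and "A' = good (2 * t + 2)"
  have ev: "A \<in> sets M" "B \<in> sets M" "A' \<in> sets M" "B - A' \<in> sets M"
    using t good_events by (auto simp: A_def B_def A'_def)
  define X' Z' where "X' = X (2 * t + 2)" and "Z' = Z (2 * t + 1)"
  define g h where "g = \<gamma> t" and "h = \<eta> t"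
  have gh: "g > 0" "h > 0" using step_pos[OF t] by (auto simp: g_def h_def)
  have Z1: "integrable M (\<lambda>\<omega>. indicator A \<omega> * (norm (Z (2 * t) \<omega>))\<^sup>2)"
    "(\<integral>\<omega>. indicator A \<omega> * (norm (Z (2 * t) \<omega>))\<^sup>2 \<partial>M) \<le> noise_const * prob A"
    unfolding A_def using t
    by (intro noise_second_moment good_in_history good_in_double_ball; simp)+
  have Z2: "integrable M (\<lambda>\<omega>. indicator B \<omega> * (norm (Z' \<omega>))\<^sup>2)"
    "(\<integral>\<omega>. indicator B \<omega> * (norm (Z' \<omega>))\<^sup>2 \<partial>M) \<le> noise_const * prob B"
    unfolding B_def Z'_def using t
    by (intro noise_second_moment good_in_history good_in_double_ball; simp)+
  have P1: "integrable M (\<lambda>\<omega>. probe t \<omega> \<bullet> Z (2 * t) \<omega>)" "(\<integral>\<omega>. probe t \<omega> \<bullet> Z (2 * t) \<omega> \<partial>M) = 0"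
    using t noise_orthogonal[of "2 * t" A "probe t" "2 * L * \<rho>", OF _ _ _ measurable_probe[OF t]]
      good_in_history good_in_double_ball norm_probe_le[OF t]
    by (auto simp: A_def)
  define f where "f \<omega> = indicat_real B \<omega> *\<^sub>R (X (2 * t) \<omega> - xs)" for \<omega>
  have fm: "f \<in> borel_measurable (\<F> (2 * t + 1))"
    unfolding f_def B_def using t
    by (intro borel_measurable_scaleR borel_measurable_diff borel_measurable_indicator
        measurable_history good_in_history) auto
  have fb: "norm (f \<omega>) \<le> \<rho> * indicator B \<omega>" for \<omega>
  proof (cases "\<omega> \<in> B")
    case True
    then have "\<omega> \<in> good (2 * t)" unfolding B_def using good_antimono[of "2 * t" "2 * t + 1"] by auto
    then show ?thesis
      using goodD[of \<omega> "2 * t"] t True by (auto simp: f_def dist_norm norm_minus_commute)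
  qed (simp add: f_def)
  have P2: "integrable M (\<lambda>\<omega>. f \<omega> \<bullet> Z' \<omega>)" "(\<integral>\<omega>. f \<omega> \<bullet> Z' \<omega> \<partial>M) = 0"
    using t noise_orthogonal[of "2 * t + 1" B f \<rho>, OF _ _ _ fm fb]
      good_in_history good_in_double_ball[of _ "2 * t + 1"]
    by (auto simp: B_def Z'_def)
  have E1: "integrable M (\<lambda>\<omega>. indicator A \<omega> * (norm (X (2 * t) \<omega> - xs))\<^sup>2)"
    using integrable_sq_err[OF t ev(1)] by (simp add: A_def)
  have E2: "integrable M (\<lambda>\<omega>. indicator A' \<omega> * (norm (X' \<omega> - xs))\<^sup>2)"
    using integrable_sq_err[of "Suc t" A'] ev(3) by (simp add: A'_def X'_def)
  have sq: "sq_err t = (\<integral>\<omega>. indicator A \<omega> * (norm (X (2 * t) \<omega> - xs))\<^sup>2 \<partial>M)"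
    "sq_err (Suc t) = (\<integral>\<omega>. indicator A' \<omega> * (norm (X' \<omega> - xs))\<^sup>2 \<partial>M)"
    by (simp_all add: sq_err_def A_def A'_def X'_def)
  note int [simp] = Z1(1) Z2(1) P1(1) P2(1) E1 E2 ev
  have "\<rho>\<^sup>2 * prob (B - A') + sq_err (Suc t) =
      (\<integral>\<omega>. \<rho>\<^sup>2 * indicator (B - A') \<omega> + indicator A' \<omega> * (norm (X' \<omega> - xs))\<^sup>2 \<partial>M)"
    unfolding sq using ev sets.sets_into_space[of "B - A'" M]
    by (subst Bochner_Integration.integral_add) (auto simp: Int_absorb2)
  also have "\<dots> \<le> (\<integral>\<omega>. (1 - g * h * m\<^sup>2) * (indicator A \<omega> * (norm (X (2 * t) \<omega> - xs))\<^sup>2)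
      - 2 * h * (f \<omega> \<bullet> Z' \<omega>)
      - 2 * h * g * (probe t \<omega> \<bullet> Z (2 * t) \<omega>)
      + 11 * L * h * g\<^sup>2 * (indicator A \<omega> * (norm (Z (2 * t) \<omega>))\<^sup>2)
      + h\<^sup>2 * (8 * L\<^sup>2 * \<rho>\<^sup>2 * indicator A \<omega>
        + 2 * (indicator B \<omega> * (norm (Z' \<omega>))\<^sup>2)) \<partial>M)"
    using drift_pointwise[OF t, folded g_def h_def A_def B_def A'_def X'_def Z'_def, folded f_def]
    by (intro integral_mono) simp_all
  also have "\<dots> = (1 - g * h * m\<^sup>2) * sq_err t
      + 11 * L * h * g\<^sup>2 * (\<integral>\<omega>. indicator A \<omega> * (norm (Z (2 * t) \<omega>))\<^sup>2 \<partial>M)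
      + h\<^sup>2 * (8 * L\<^sup>2 * \<rho>\<^sup>2 * prob A
        + 2 * (\<integral>\<omega>. indicator B \<omega> * (norm (Z' \<omega>))\<^sup>2 \<partial>M))"
    by (simp add: sq P1(2) P2(2))
  also have "\<dots> \<le> (1 - g * h * m\<^sup>2) * sq_err t + 11 * L * h * g\<^sup>2 * (noise_const * prob (good 2))
      + h\<^sup>2 * (8 * L\<^sup>2 * \<rho>\<^sup>2 * prob (good 2) + 2 * (noise_const * prob (good 2)))"
  proof -
    have "prob A \<le> prob (good 2)" "prob B \<le> prob (good 2)"
      using t good_events unfolding A_def B_def by (intro finite_measure_mono good_antimono; simp)+
    moreover from this noise_const_ge_1 have "noise_const * prob A \<le> noise_const * prob (good 2)" "noise_const * prob B \<le> noise_const * prob (good 2)"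
      by (auto intro: mult_left_mono)
    ultimately show ?thesis
      using Z1(2) Z2(2) gh constants by (intro add_mono mult_left_mono order_refl) auto
  qed
  also have "\<dots> \<le> (1 - g * h * m\<^sup>2) * sq_err t + drift_const * (h * g\<^sup>2 + h\<^sup>2) * prob (good 2)"
  proof -
    have "0 \<le> 11 * L * noise_const * h\<^sup>2 * prob (good 2)"
      "0 \<le> (8 * L\<^sup>2 * \<rho>\<^sup>2 + 2 * noise_const) * (h * g\<^sup>2) * prob (good 2)"
      using constants noise_const_ge_1 gh by auto
    then show ?thesis by (simp add: drift_const_def algebra_simps)
  qed
  finally show ?thesis unfolding A'_def B_def g_def h_def .
qed

section \<open>Survival with high probability\<close>

text \<open>
  From one integer time to the next the good event loses the paths that leave at the half step and
  those that leave at the full step; the bound for the latter telescopes.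
\<close>

lemma prob_good_loss:
  "prob (good 2) \<le> prob (good (2 * Suc T)) + (sq_err 1 - sq_err (Suc T)) / \<rho>\<^sup>2
    + (\<Sum>t=1..T. drift_const * (\<eta> t * (\<gamma> t)\<^sup>2 + (\<eta> t)\<^sup>2) / \<rho>\<^sup>2 + noise_const * (2 * \<gamma> t / \<rho>) powr q) * prob (good 2)"
proof (induction T)
  case 0
  show ?case by simp
next
  case (Suc T)
  define t where "t = Suc T"
  have t: "t \<ge> 1" by (simp add: t_def)
  define A B A' where "A = good (2 * t)" and "B = good (2 * t + 1)" and "A' = good (2 * t + 2)"
  have ev: "A \<in> sets M" "B \<in> sets M" "A' \<in> sets M"
    using t good_events by (auto simp: A_def B_def A'_def)
  have "B \<subseteq> A" "A' \<subseteq> B" unfolding A_def B_def A'_def by (intro good_antimono; simp)+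
  then have d: "prob A = prob (A - B) + prob (B - A') + prob A'"
    using ev finite_measure_Diff[of A B] finite_measure_Diff[of B A'] by simp
  have "0 \<le> sq_err t" unfolding sq_err_def by (intro integral_nonneg_AE) auto
  then have "(1 - \<gamma> t * \<eta> t * m\<^sup>2) * sq_err t \<le> sq_err t"
    using step_pos[OF t] by (intro mult_left_le_one_le) (use small(2)[OF t] in auto)
  then have "\<rho>\<^sup>2 * prob (B - A')
      \<le> sq_err t - sq_err (Suc t) + drift_const * (\<eta> t * (\<gamma> t)\<^sup>2 + (\<eta> t)\<^sup>2) * prob (good 2)"
    using drift[OF t] by (simp add: A'_def B_def)
  then have "prob (B - A') \<le>
      (sq_err t - sq_err (Suc t) + drift_const * (\<eta> t * (\<gamma> t)\<^sup>2 + (\<eta> t)\<^sup>2) * prob (good 2)) / \<rho>\<^sup>2"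
    using \<rho>_pos by (simp add: pos_le_divide_eq mult.commute)
  then have "prob (B - A') \<le> (sq_err t - sq_err (Suc t)) / \<rho>\<^sup>2
      + drift_const * (\<eta> t * (\<gamma> t)\<^sup>2 + (\<eta> t)\<^sup>2) / \<rho>\<^sup>2 * prob (good 2)"
    by (simp add: add_divide_distrib)
  moreover have "prob (A - B) \<le> noise_const * (2 * \<gamma> t / \<rho>) powr q * prob (good 2)"
    using prob_half_step_exit[OF t] by (simp add: A_def B_def)
  moreover have "(sq_err 1 - sq_err (Suc t)) / \<rho>\<^sup>2
      = (sq_err 1 - sq_err t) / \<rho>\<^sup>2 + (sq_err t - sq_err (Suc t)) / \<rho>\<^sup>2"
    by (simp add: diff_divide_distrib)
  moreover have "2 * Suc t = 2 * t + 2" by simp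
  moreover have "(\<Sum>s=1..t. F s) = (\<Sum>s=1..T. F s) + F t" for F :: "nat \<Rightarrow> real"
    by (simp add: t_def)
  ultimately show ?case
    using Suc.IH d unfolding t_def[symmetric] A_def[symmetric]
    by (simp only: A'_def[symmetric] distrib_right)
qed

lemma good_events_decseq: "decseq (\<lambda>t. good (2 * Suc t))"
  unfolding decseq_def using good_antimono by auto

text \<open>
  The bound of \<open>prob_good_loss\<close> does not depend on \<open>T\<close> after the initial error is estimated by
  \<open>u\<^sup>2\<close>, so it passes to the limit of the decreasing events.  It is relative to the probability of the
  starting event, hence yields a conditional statement however small that probability is.
\<close>

lemma prob_all_good:
  assumes "U \<subseteq> cball xs u" "u \<ge> 0"
    and sum: "\<And>T. (\<Sum>t=1..T. drift_const * (\<eta> t * (\<gamma> t)\<^sup>2 + (\<eta> t)\<^sup>2) / \<rho>\<^sup>2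
      + noise_const * (2 * \<gamma> t / \<rho>) powr q) \<le> \<epsilon>"
  shows "(1 - (u / \<rho>)\<^sup>2 - \<epsilon>) * prob (good 2) \<le> prob (\<Inter>t. good (2 * Suc t))"
proof -
  have "sq_err 1 \<le> (\<integral>\<omega>. u\<^sup>2 * indicator (good 2) \<omega> \<partial>M)"
    unfolding sq_err_def
  proof (rule integral_mono)
    show "integrable M (\<lambda>\<omega>. indicator (good (2 * 1)) \<omega> * (norm (X (2 * 1) \<omega> - xs))\<^sup>2)"
      using integrable_sq_err[of 1 "good 2"] good_events by simp
    show "integrable M (\<lambda>\<omega>. u\<^sup>2 * indicat_real (good 2) \<omega>)" using good_events by simp
    fix \<omega>
    show "indicat_real (good (2 * 1)) \<omega> * (norm (X (2 * 1) \<omega> - xs))\<^sup>2 \<le> u\<^sup>2 * indicator (good 2) \<omega>"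
    proof (cases "\<omega> \<in> good 2")
      case True
      then have "norm (X 2 \<omega> - xs) \<le> u"
        using assms(1) by (auto simp: good_2 dist_norm norm_minus_commute)
      then show ?thesis using True by (simp add: power_mono)
    qed simp
  qed
  also have "\<dots> = u\<^sup>2 * prob (good 2)" using good_events by simp
  finally have one: "sq_err 1 / \<rho>\<^sup>2 \<le> (u / \<rho>)\<^sup>2 * prob (good 2)"
    using \<rho>_pos by (simp add: power_divide divide_right_mono)
  have bound: "(1 - (u / \<rho>)\<^sup>2 - \<epsilon>) * prob (good 2) \<le> prob (good (2 * Suc T))" for T
  proof -
    have "0 \<le> sq_err (Suc T)" unfolding sq_err_def by (intro integral_nonneg_AE) auto
    then have "(sq_err 1 - sq_err (Suc T)) / \<rho>\<^sup>2 \<le> sq_err 1 / \<rho>\<^sup>2"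
      by (intro divide_right_mono) auto
    moreover have "(\<Sum>t=1..T. drift_const * (\<eta> t * (\<gamma> t)\<^sup>2 + (\<eta> t)\<^sup>2) / \<rho>\<^sup>2
        + noise_const * (2 * \<gamma> t / \<rho>) powr q) * prob (good 2) \<le> \<epsilon> * prob (good 2)"
      using sum by (intro mult_right_mono) auto
    ultimately have "prob (good 2)
        \<le> prob (good (2 * Suc T)) + (u / \<rho>)\<^sup>2 * prob (good 2) + \<epsilon> * prob (good 2)"
      using prob_good_loss[of T] one by linarith
    then show ?thesis by (simp add: left_diff_distrib)
  qed
  have "(\<lambda>t. prob (good (2 * Suc t))) \<longlonglongrightarrow> prob (\<Inter>t. good (2 * Suc t))"
    using good_events by (intro finite_Lim_measure_decseq good_events_decseq) auto
  then show ?thesis by (rule LIMSEQ_le_const) (use bound in blast)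
qed

definition survival :: "'w set" where "survival = (\<Inter>t. good (2 * Suc t))"

lemma survival_event: "survival \<in> events"
  unfolding survival_def using good_events by (intro sets.countable_INT) auto

lemma survival_subset: "t \<ge> 1 \<Longrightarrow> survival \<subseteq> good (2 * t)"
  unfolding survival_def by (cases t) auto

lemma conditional_sq_err:
  assumes pos: "prob survival > 0" and t: "t \<ge> 1"
  shows "integrable (uniform_measure M survival) (\<lambda>\<omega>. (norm (X (2 * t) \<omega> - xs))\<^sup>2)"
    and "(\<integral>\<omega>. (norm (X (2 * t) \<omega> - xs))\<^sup>2 \<partial>uniform_measure M survival) \<le> sq_err t / prob survival"
proof -
  have [measurable]: "X (2 * t) \<in> borel_measurable M" using X_measurable t by auto
  have m: "(\<lambda>\<omega>. (norm (X (2 * t) \<omega> - xs))\<^sup>2) \<in> borel_measurable M" by measurable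
  note int = integrable_sq_err[OF t survival_event survival_subset[OF t]]
  note intg = integrable_sq_err[OF t good_events[of "2 * t"] order_refl]
  show "integrable (uniform_measure M survival) (\<lambda>\<omega>. (norm (X (2 * t) \<omega> - xs))\<^sup>2)"
    by (rule integrable_uniform_measure(1)[OF survival_event pos m int])
  have "(\<integral>\<omega>. indicator survival \<omega> * (norm (X (2 * t) \<omega> - xs))\<^sup>2 \<partial>M) \<le> sq_err t"
    unfolding sq_err_def
    using survival_subset[OF t] t by (intro integral_mono int intg) (auto split: split_indicator)
  then show "(\<integral>\<omega>. (norm (X (2 * t) \<omega> - xs))\<^sup>2 \<partial>uniform_measure M survival) \<le> sq_err t / prob survival"
    unfolding integrable_uniform_measure(2)[OF survival_event pos m int]
    using pos by (intro divide_right_mono) auto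
qed

lemma all_iterates_in_ball_given_survival:
  assumes "prob survival > 0"
  shows "\<P>(\<omega> in M. (\<forall>t\<ge>1. X (2 * t) \<omega> \<in> cball xs \<rho>) \<bar> \<omega> \<in> survival) = 1"
proof -
  have "\<forall>t\<ge>1. X (2 * t) \<omega> \<in> cball xs \<rho>" if "\<omega> \<in> survival" for \<omega>
  proof (intro allI impI)
    fix t :: nat assume t: "t \<ge> 1"
    then have "\<omega> \<in> good (2 * t)" using survival_subset that by blast
    then show "X (2 * t) \<omega> \<in> cball xs \<rho>" using goodD[of \<omega> "2 * t"] t by simp
  qed
  then have "{\<omega> \<in> space M. (\<forall>t\<ge>1. X (2 * t) \<omega> \<in> cball xs \<rho>) \<and> \<omega> \<in> survival} = survival"
    "{\<omega> \<in> space M. \<omega> \<in> survival} = survival"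
    using sets.sets_into_space[OF survival_event] by blast+
  then show ?thesis using assms by (simp add: cond_prob_def)
qed

lemma survival_given_start:
  assumes "prob (good 2) > 0" "c * prob (good 2) \<le> prob survival"
  shows "c \<le> \<P>(\<omega> in M. \<omega> \<in> survival \<bar> X 2 \<omega> \<in> U)"
proof -
  have "survival \<subseteq> good 2" using survival_subset[of 1] by simp
  then have "{\<omega> \<in> space M. \<omega> \<in> survival \<and> X 2 \<omega> \<in> U} = survival"
    using sets.sets_into_space[OF survival_event] by (auto simp: good_2)
  then show ?thesis
    using assms by (simp add: cond_prob_def good_2[symmetric] pos_le_divide_eq)
qed

end

section \<open>Convergence of the extragradient method\<close>

theorem theorem4:
  fixes V :: "real ^ 'd \<Rightarrow> real ^ 'd"
    and xs :: "real ^ 'd"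
    and U\<^sub>0 :: "(real ^ 'd) set"
    and L q \<sigma> \<kappa> \<delta> \<gamma> :: real
  assumes isolated_solution: "xs isolated_in {x. V x = 0}"
    and U0_neighborhood: "xs \<in> interior U\<^sub>0"
    and constants: "L \<ge> 0" "q > 3" "\<sigma> \<ge> 0" "\<kappa> \<ge> 0"
    and lipschitz: "\<forall>x\<in>U\<^sub>0. \<forall>x'\<in>U\<^sub>0. norm (V x' - V x) \<le> L * norm (x' - x)"
    and monotone: "\<forall>x\<in>U\<^sub>0. V x \<bullet> (x - xs) \<ge> 0"
    and differentiable: "V differentiable (at xs)"
    and jacobian_invertible: "invertible (jacobian V (at xs))"
    and tolerance: "\<delta> > 0"
    and gamma_pos: "\<gamma> > 0"
  shows "\<exists>\<eta>\<^sub>0>0. \<forall>\<eta>>\<eta>\<^sub>0. \<exists>b\<^sub>0>0. \<forall>b>b\<^sub>0.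
    \<exists>U U'.
      xs \<in> interior U \<and> U \<in> sets borel \<and>
      xs \<in> interior U' \<and> U' \<in> sets borel \<and>
      (\<forall>(M :: 'w measure) X Z.
         dseg M V (\<lambda>t. \<gamma> / (real t + b) powr (1/3)) (\<lambda>t. \<eta> / (real t + b) powr (2/3)) X Z \<longrightarrow>
         local_noise M X Z xs U\<^sub>0 q \<sigma> \<kappa> \<longrightarrow>
         \<P>(\<omega> in M. X 2 \<omega> \<in> U) > 0 \<longrightarrow>
         (\<exists>E\<in>sets M.
            \<P>(\<omega> in M. \<omega> \<in> E \<bar> X 2 \<omega> \<in> U) \<ge> 1 - \<delta> \<and>
            \<P>(\<omega> in M. (\<forall>t\<ge>1. X (2 * t) \<omega> \<in> U') \<bar> \<omega> \<in> E) = 1 \<and>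
            (\<forall>t\<ge>1. integrable (uniform_measure M E) (\<lambda>\<omega>. (norm (X (2 * t) \<omega> - xs))\<^sup>2)) \<and>
            (\<lambda>t. \<integral>\<omega>. (norm (X (2 * t) \<omega> - xs))\<^sup>2 \<partial>uniform_measure M E)
              \<in> O(\<lambda>t. 1 / real t powr (1/3))))"
proof -
  let "\<exists>\<eta>\<^sub>0>0. \<forall>\<eta>>\<eta>\<^sub>0. \<exists>b\<^sub>0>0. \<forall>b>b\<^sub>0. \<exists>U U'. ?P \<eta> b U U'" = ?thesis
  have zero: "V xs = 0" using isolated_solution by (simp add: isolated_in_def)
  obtain m r where m: "m > 0" and r: "r > 0"
    and low: "\<And>y. dist xs y < r \<Longrightarrow> m * norm (y - xs) \<le> norm (V y - V xs)"
    using norm_lower_bound_of_invertible_jacobian[OF differentiable jacobian_invertible] by blast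
  obtain R where R: "R > 0" "cball xs R \<subseteq> U\<^sub>0"
    using U0_neighborhood mem_interior_cball by blast
  define \<rho> where "\<rho> = min (R / 2) (r / 2)"
  have \<rho>: "\<rho> > 0" "2 * \<rho> \<le> R" "\<rho> < r" using R r by (auto simp: \<rho>_def)
  have ball: "cball xs (2 * \<rho>) \<subseteq> U\<^sub>0" using \<rho> R by auto
  \<comment> \<open>For large tolerances a smaller one is used, so that the surviving event has positive probability and can be conditioned on.\<close>
  define \<delta>' where "\<delta>' = min \<delta> (1/2)"
  have \<delta>': "\<delta>' > 0" "\<delta>' \<le> \<delta>" "\<delta>' < 1" using tolerance by (auto simp: \<delta>'_def)
  \<comment> \<open>Half of the tolerance is spent on the initial error; each of the two series below gets a quarter.\<close>
  define u where "u = \<rho> * sqrt (\<delta>' / 2)"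
  have u: "u > 0" "u \<le> \<rho>" "(u / \<rho>)\<^sup>2 = \<delta>' / 2"
    using \<rho> \<delta>' by (auto simp: u_def mult_le_cancel_left1)
  define S where "S = 1 + (\<sigma> + \<kappa> * (2 * \<rho>)) powr q"
  define K where "K = 11 * L * S + 8 * L\<^sup>2 * \<rho>\<^sup>2 + 2 * S"
  have SK: "S \<ge> 0" "K \<ge> 0" using constants by (auto simp: S_def K_def)
  \<comment> \<open>With this threshold \<open>\<gamma> \<eta> m\<^sup>2 \<ge> 2\<close>, as the recursion for the rate demands.\<close>
  show ?thesis
  proof (rule exI[of _ "2 / (m\<^sup>2 * \<gamma>)"], intro conjI allI impI)
    show "0 < 2 / (m\<^sup>2 * \<gamma>)" using m gamma_pos by simp
    fix \<eta> assume "2 / (m\<^sup>2 * \<gamma>) < \<eta>"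
    moreover have "0 < 2 / (m\<^sup>2 * \<gamma>)" using m gamma_pos by simp
    ultimately have \<eta>: "\<eta> > 0" and p2: "2 \<le> \<gamma> * \<eta> * m\<^sup>2"
      using m gamma_pos by (linarith, simp add: pos_divide_less_eq mult_ac)
    define C\<^sub>1 where "C\<^sub>1 = K * (\<eta> * \<gamma>\<^sup>2 + \<eta>\<^sup>2)"
    define C\<^sub>2 where "C\<^sub>2 = S * (2 * \<gamma> / \<rho>) powr q"
    have C: "C\<^sub>1 \<ge> 0" "C\<^sub>2 \<ge> 0" using SK \<eta> by (auto simp: C\<^sub>1_def C\<^sub>2_def)
    have "\<forall>\<^sub>F b in at_top. (\<forall>T. (\<Sum>t=1..T::nat. C\<^sub>1 / \<rho>\<^sup>2 / (real t + b) powr (4/3)) \<le> \<delta>' / 4) \<and>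
        (\<forall>T. (\<Sum>t=1..T::nat. C\<^sub>2 / (real t + b) powr (q/3)) \<le> \<delta>' / 4)"
      using constants C \<delta>' by (intro eventually_conj eventually_shifted_power_sum_le) auto
    then obtain N where N: "\<And>b T. b \<ge> N \<Longrightarrow> (\<Sum>t=1..T::nat. C\<^sub>1 / \<rho>\<^sup>2 / (real t + b) powr (4/3)) \<le> \<delta>' / 4"
      "\<And>b T. b \<ge> N \<Longrightarrow> (\<Sum>t=1..T::nat. C\<^sub>2 / (real t + b) powr (q/3)) \<le> \<delta>' / 4"
      unfolding eventually_at_top_linorder by blast
    \<comment> \<open>The threshold for \<open>b\<close> makes the two series small, gives \<open>3 L \<gamma>\<^sub>t \<le> 1\<close>, and keeps the contraction factor nonnegative.\<close>
    define b\<^sub>0 where "b\<^sub>0 = Max {1, N, (3 * L * \<gamma>) ^ 3, \<gamma> * \<eta> * m\<^sup>2}"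
    show "\<exists>b\<^sub>0>0. \<forall>b>b\<^sub>0. \<exists>U U'. ?P \<eta> b U U'"
    proof (rule exI[of _ b\<^sub>0], intro conjI allI impI)
      show "0 < b\<^sub>0" by (simp add: b\<^sub>0_def less_max_iff_disj)
      fix b assume "b\<^sub>0 < b"
      then have b: "b > 1" "b \<ge> N" "b \<ge> (3 * L * \<gamma>) ^ 3" "b \<ge> \<gamma> * \<eta> * m\<^sup>2"
        by (auto simp: b\<^sub>0_def)
      let ?\<gamma> = "\<lambda>t::nat. \<gamma> / (real t + b) powr (1/3)" and ?\<eta> = "\<lambda>t::nat. \<eta> / (real t + b) powr (2/3)"
      have s: "real t + b > 0" for t using b by simp
      note prods = dseg_stepsize_products[OF s]
      have small1: "3 * (L * ?\<gamma> t) \<le> 1" for t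
      proof -
        have "3 * L * \<gamma> = ((3 * L * \<gamma>) ^ 3) powr (1/3)"
          using constants gamma_pos by (intro powr_one_third_cube[symmetric]) auto
        also have "\<dots> \<le> (real t + b) powr (1/3)"
          using b constants gamma_pos by (intro powr_mono2) auto
        finally show ?thesis using s[of t] by (simp add: pos_divide_le_eq mult_ac)
      qed
      have small2: "?\<gamma> t * ?\<eta> t * m\<^sup>2 \<le> 1" for t
        unfolding prods using s[of t] b by simp
      have sums: "(\<Sum>t=1..T. K * (?\<eta> t * (?\<gamma> t)\<^sup>2 + (?\<eta> t)\<^sup>2) / \<rho>\<^sup>2
          + S * (2 * ?\<gamma> t / \<rho>) powr q) \<le> \<delta>' / 2" for T
      proof -
        have "(\<Sum>t=1..T. K * (?\<eta> t * (?\<gamma> t)\<^sup>2 + (?\<eta> t)\<^sup>2) / \<rho>\<^sup>2 + S * (2 * ?\<gamma> t / \<rho>) powr q)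
          = (\<Sum>t=1..T. C\<^sub>1 / \<rho>\<^sup>2 / (real t + b) powr (4/3)) + (\<Sum>t=1..T. C\<^sub>2 / (real t + b) powr (q/3))"
          unfolding sum.distrib[symmetric] prods by (simp add: C\<^sub>1_def C\<^sub>2_def mult_ac)
        then show ?thesis using N[OF b(2), of T] by simp
      qed
      show "\<exists>U U'. ?P \<eta> b U U'"
      proof (rule exI[of _ "cball xs u"], rule exI[of _ "cball xs \<rho>"], intro conjI allI impI)
        show "xs \<in> interior (cball xs u)" "xs \<in> interior (cball xs \<rho>)"
          using u \<rho> by (simp_all add: interior_cball)
        fix M :: "'w measure" and X Z
        assume alg: "dseg M V ?\<gamma> ?\<eta> X Z" and noise: "local_noise M X Z xs U\<^sub>0 q \<sigma> \<kappa>"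
          and start: "\<P>(\<omega> in M. X 2 \<omega> \<in> cball xs u) > 0"
        interpret local_dseg M V ?\<gamma> ?\<eta> X Z xs U\<^sub>0 "cball xs u" L q \<sigma> \<kappa> m \<rho>
        proof (intro local_dseg.intro local_dseg_axioms.intro)
          show "dseg M V ?\<gamma> ?\<eta> X Z" by (fact alg)
          show "local_noise M X Z xs U\<^sub>0 q \<sigma> \<kappa>" by (fact noise)
          show "norm (V y - V x) \<le> L * norm (y - x)"
            if "x \<in> cball xs (2 * \<rho>)" "y \<in> cball xs (2 * \<rho>)" for x y
            using lipschitz ball that by blast
          show "V x \<bullet> (x - xs) \<ge> 0" if "x \<in> cball xs (2 * \<rho>)" for x
            using monotone ball that by blast
          show "m * norm (x - xs) \<le> norm (V x)" if "x \<in> cball xs \<rho>" for x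
            using low[of x] that \<rho> zero by simp
        qed (use \<rho> ball zero constants m u small1 small2 in auto)
        have S_eq: "noise_const = S"
          by (simp add: S_def noise_const_def)
        have K_eq: "drift_const = K"
          by (simp add: K_def drift_const_def S_eq)
        have start': "prob (good 2) > 0" using start by (simp add: good_2)
        have "(1 - (u / \<rho>)\<^sup>2 - \<delta>' / 2) * prob (good 2) \<le> prob survival"
          unfolding survival_def using u sums by (intro prob_all_good) (auto simp: S_eq K_eq)
        then have surv: "(1 - \<delta>') * prob (good 2) \<le> prob survival" by (simp add: u(3))
        have "0 < (1 - \<delta>') * prob (good 2)" using start' \<delta>' by simp
        with surv have pos: "prob survival > 0" by linarith
        have rec: "sq_err (Suc t) \<le> (1 - \<gamma> * \<eta> * m\<^sup>2 / (real t + b)) * sq_err t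
            + C\<^sub>1 * prob (good 2) / (real t + b) powr (4/3)" if "t \<ge> 1" for t
        proof -
          have "0 \<le> \<rho>\<^sup>2 * prob (good (2 * t + 1) - good (2 * t + 2))" by simp
          then have "sq_err (Suc t) \<le> (1 - ?\<gamma> t * ?\<eta> t * m\<^sup>2) * sq_err t
              + K * (?\<eta> t * (?\<gamma> t)\<^sup>2 + (?\<eta> t)\<^sup>2) * prob (good 2)"
            using drift[OF that] unfolding K_eq by linarith
          then show ?thesis unfolding prods by (simp add: C\<^sub>1_def)
        qed
        obtain A where A: "\<And>t. t \<ge> 1 \<Longrightarrow> sq_err t \<le> A / (real t + b) powr (1/3)"
          using recursion_rate_one_third[OF rec p2] b C(1) by auto
        show "\<exists>E\<in>sets M.
            \<P>(\<omega> in M. \<omega> \<in> E \<bar> X 2 \<omega> \<in> cball xs u) \<ge> 1 - \<delta> \<and>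
            \<P>(\<omega> in M. (\<forall>t\<ge>1. X (2 * t) \<omega> \<in> cball xs \<rho>) \<bar> \<omega> \<in> E) = 1 \<and>
            (\<forall>t\<ge>1. integrable (uniform_measure M E) (\<lambda>\<omega>. (norm (X (2 * t) \<omega> - xs))\<^sup>2)) \<and>
            (\<lambda>t. \<integral>\<omega>. (norm (X (2 * t) \<omega> - xs))\<^sup>2 \<partial>uniform_measure M E)
              \<in> O(\<lambda>t. 1 / real t powr (1/3))"
        proof (intro bexI[OF _ survival_event] conjI allI impI)
          show "\<P>(\<omega> in M. \<omega> \<in> survival \<bar> X 2 \<omega> \<in> cball xs u) \<ge> 1 - \<delta>"
            using survival_given_start[OF start' surv] \<delta>'(2) by linarith
          show "\<P>(\<omega> in M. (\<forall>t\<ge>1. X (2 * t) \<omega> \<in> cball xs \<rho>) \<bar> \<omega> \<in> survival) = 1"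
            by (rule all_iterates_in_ball_given_survival[OF pos])
          show "integrable (uniform_measure M survival) (\<lambda>\<omega>. (norm (X (2 * t) \<omega> - xs))\<^sup>2)"
            if "t \<ge> 1" for t
            by (rule conditional_sq_err(1)[OF pos that])
          show "(\<lambda>t. \<integral>\<omega>. (norm (X (2 * t) \<omega> - xs))\<^sup>2 \<partial>uniform_measure M survival)
              \<in> O(\<lambda>t. 1 / real t powr (1/3))"
          proof (rule bigoI)
            show "\<forall>\<^sub>F t in sequentially.
                norm (\<integral>\<omega>. (norm (X (2 * t) \<omega> - xs))\<^sup>2 \<partial>uniform_measure M survival)
                \<le> max A 0 / prob survival * norm (1 / real t powr (1/3))"
              using eventually_ge_at_top[of 1]
            proof eventually_elim
              case (elim t)
              let ?I = "\<integral>\<omega>. (norm (X (2 * t) \<omega> - xs))\<^sup>2 \<partial>uniform_measure M survival"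
              have "sq_err t \<le> A / (real t + b) powr (1/3)" using A elim by simp
              also have "\<dots> \<le> max A 0 / (real t + b) powr (1/3)" by (intro divide_right_mono) auto
              also have "\<dots> \<le> max A 0 / real t powr (1/3)"
                using elim b by (intro divide_left_mono powr_mono2 mult_pos_pos) auto
              finally have "sq_err t / prob survival \<le> max A 0 / real t powr (1/3) / prob survival"
                using pos by (intro divide_right_mono) auto
              moreover have "0 \<le> ?I" by (intro integral_nonneg_AE) auto
              ultimately show ?case using conditional_sq_err(2)[OF pos elim] by (simp add: mult_ac)
            qed
          qed
        qed
      qed auto
    qed
  qed
qed

end
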